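(* The set $\mathcal L_{\circ+}$ is locally asymptotically stable for the map $\Theta$. That is, for every $\Lambda_\circ\in\mathcal L_{\circ+}$ there exists a neighborhood $\mathcal B(\Lambda_\circ)$ of $\Lambda_\circ$ in $\mathfrak H_n$ such that every trajectory $\{\Lambda_k\}_{k\ge 0}$ generated by the iteration $\Lambda_{k+1}=\Theta(\Lambda_k)$ with $\Lambda_0\in\mathcal B(\Lambda_\circ)$ converges to $\mathcal L_{\circ+}$.
   Context: Notation. $\mathbb T$ is the unit circle in $\mathbb C$; $\mathfrak H_n$ is the real vector space of $n\times n$ Hermitian matrices; $C_+(\mathbb T)$ is the set of continuous, real-valued, strictly positive functions on $\mathbb T$. For a (matrix-valued) function $f$ on $\mathbb T$, $\int f:=\frac{1}{2\pi}\int_{-\pi}^{\pi}f(e^{j\vartheta})\,d\vartheta$. The superscript $*$ is the conjugate transpose (on $\mathbb T$, for functions). For $\Lambda\ge 0$ Hermitian, $\Lambda^{1/2}$ is the positive semidefinite square root. Standing assumptions. $A\in\mathbb C^{n\times n}$ has all its eigenvalues in the open unit disc and at least one eigenvalue equal to $0$; $B\in\mathbb C^{n\times 1}$; the pair $(A,B)$ is reachable; $G(z)=(zI-A)^{-1}B$. $\Psi\in C_+(\mathbb T)$ with $\int\Psi=1$. There exists $\Phi\in C_+(\mathbb T)$ with $\int G\Phi G^*=I$, and (normalization) every such $\Phi$ satisfies $\int\Phi=1$. Definitions. $$\Theta(\Lambda):=\int \Lambda^{1/2}G\left[\frac{\Psi}{G^*\Lambda G}\right]G^*\Lambda^{1/2},\qquad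 \Lambda\in\mathfrak H_n,\ \Lambda>0 .$$ The map $\Theta$ sends positive definite matrices to positive definite matrices, so the iteration is well defined from any $\Lambda_0>0$; neighborhoods $\mathcal B(\Lambda_\circ)$ are understood to consist of positive definite matrices. $$\mathcal L_{\circ}:=\Big\{\Lambda\in\mathfrak H_n:\ G^*\Lambda G>0 \text{ on } \mathbb T,\ \int G\frac{\Psi}{G^*\Lambda G}G^*=I\Big\},\qquad \mathcal L_{\circ+}:=\{\Lambda\in\mathcal L_\circ:\ \Lambda>0\}.$$ "Converges to $\mathcal L_{\circ+}$" means that the distance of $\Lambda_k$ from $\mathcal L_{\circ+}$ tends to $0$ as $k\to\infty$. *)

theory Defs
  imports "HOL-Analysis.Analysis"
begin

text \<open>Matrices over \<open>complex\<close> of size \<open>n\<close> are elements of \<^typ>\<open>complex^'n^'n\<close> with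
  \<open>n = CARD('n)\<close>; column vectors (\<open>n \<times> 1\<close> matrices) are elements of \<^typ>\<open>complex^'n\<close>.\<close>

definition is_eigenvalue :: "complex^'n^'n \<Rightarrow> complex \<Rightarrow> bool" where
  "is_eigenvalue A c \<longleftrightarrow> (\<exists>v. v \<noteq> 0 \<and> A *v v = c *s v)"

definition reachable :: "complex^'n^'n \<Rightarrow> complex^'n \<Rightarrow> bool" where
  "reachable A B \<longleftrightarrow> vec.span {(((*v) A) ^^ k) B |k. k < CARD('n)} = UNIV"

definition ctranspose :: "complex^'n^'m \<Rightarrow> complex^'m^'n" where
  "ctranspose M = (\<chi> i j. cnj (M $ j $ i))"

definition hermitian :: "complex^'n^'n \<Rightarrow> bool" where
  "hermitian M \<longleftrightarrow> ctranspose M = M"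

text \<open>The scalar \<open>x\<^sup>* M x\<close>.\<close>

definition cform :: "complex^'n^'n \<Rightarrow> complex^'n \<Rightarrow> complex" where
  "cform M x = (\<Sum>i\<in>UNIV. cnj (x $ i) * (M *v x) $ i)"

text \<open>All uses of \<open>cform\<close> below are for Hermitian matrices, where it is real, so that taking
  the real part loses nothing.\<close>

lemma cform_hermitian_real:
  assumes "hermitian M"
  shows "cform M x = of_real (Re (cform M x))"
proof -
  have M: "cnj (M $ i $ j) = M $ j $ i" for i j
  proof -
    have "ctranspose M $ j $ i = M $ j $ i"
      using assms by (simp add: hermitian_def)
    then show ?thesis by (simp add: ctranspose_def)
  qed
  have "cnj (cform M x) = (\<Sum>i\<in>UNIV. \<Sum>j\<in>UNIV. x $ i * (M $ j $ i * cnj (x $ j)))"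
    by (simp add: cform_def matrix_vector_mult_def sum_distrib_left M)
  also have "\<dots> = (\<Sum>j\<in>UNIV. \<Sum>i\<in>UNIV. x $ i * (M $ j $ i * cnj (x $ j)))"
    by (rule sum.swap)
  also have "\<dots> = cform M x"
    by (simp add: cform_def matrix_vector_mult_def sum_distrib_left algebra_simps)
  finally show ?thesis
    by (metis Reals_cnj_iff of_real_Re)
qed

definition posdef :: "complex^'n^'n \<Rightarrow> bool" where
  "posdef M \<longleftrightarrow> hermitian M \<and> (\<forall>x. x \<noteq> 0 \<longrightarrow> Re (cform M x) > 0)"

definition possemidef :: "complex^'n^'n \<Rightarrow> bool" where
  "possemidef M \<longleftrightarrow> hermitian M \<and> (\<forall>x. Re (cform M x) \<ge> 0)"

definition msqrt :: "complex^'n^'n \<Rightarrow> complex^'n^'n" where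
  "msqrt M = (THE R. possemidef R \<and> R ** R = M)"

text \<open>The rank-one matrix \<open>x x\<^sup>*\<close>.\<close>

definition outer :: "complex^'n \<Rightarrow> complex^'n^'n" where
  "outer x = (\<chi> i j. x $ i * cnj (x $ j))"

abbreviation unit_circle :: "complex set" where
  "unit_circle \<equiv> sphere 0 1"

text \<open>Functions on the circle are total functions on \<^typ>\<open>complex\<close>; only their values on the
  circle matter.\<close>

definition Cplus :: "(complex \<Rightarrow> real) set" where
  "Cplus = {f. continuous_on unit_circle f \<and> (\<forall>z\<in>unit_circle. f z > 0)}"

definition circle_mean :: "(complex \<Rightarrow> 'b::euclidean_space) \<Rightarrow> 'b" where
  "circle_mean f = (1 / (2 * pi)) *\<^sub>R integral {-pi..pi} (\<lambda>t. f (cis t))"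

definition transfer :: "complex^'n^'n \<Rightarrow> complex^'n \<Rightarrow> complex \<Rightarrow> complex^'n" where
  "transfer A B z = matrix_inv (mat z - A) *v B"

definition Theta ::
  "complex^'n^'n \<Rightarrow> complex^'n \<Rightarrow> (complex \<Rightarrow> real) \<Rightarrow> complex^'n^'n \<Rightarrow> complex^'n^'n" where
  "Theta A B \<Psi> L = circle_mean (\<lambda>z.
     msqrt L ** ((\<Psi> z / Re (cform L (transfer A B z))) *\<^sub>R outer (transfer A B z)) ** msqrt L)"

definition L_circ ::
  "complex^'n^'n \<Rightarrow> complex^'n \<Rightarrow> (complex \<Rightarrow> real) \<Rightarrow> (complex^'n^'n) set" where
  "L_circ A B \<Psi> = {L. hermitian L \<and>
     (\<forall>z\<in>unit_circle. Re (cform L (transfer A B z)) > 0) \<and>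
     circle_mean (\<lambda>z. (\<Psi> z / Re (cform L (transfer A B z))) *\<^sub>R outer (transfer A B z)) = mat 1}"

definition L_circ_plus ::
  "complex^'n^'n \<Rightarrow> complex^'n \<Rightarrow> (complex \<Rightarrow> real) \<Rightarrow> (complex^'n^'n) set" where
  "L_circ_plus A B \<Psi> = {L \<in> L_circ A B \<Psi>. posdef L}"

end

theory Submission
  imports Defs
begin

text \<open>
  Write \<open>P z = G(z) G(z)\<^sup>*\<close>, so that \<open>G\<^sup>* \<Lambda> G\<close> is the Frobenius product \<open>P \<bullet> \<Lambda>\<close>, and let
  \<open>M(\<Lambda>) = \<integral> \<Psi> P / (P \<bullet> \<Lambda>)\<close>.  Then \<open>\<Theta>(\<Lambda>) = C\<^sub>\<Lambda> (M(\<Lambda>))\<close> with \<open>C\<^sub>\<Lambda> Y = \<Lambda>\<^sup>1\<^sup>/\<^sup>2 Y \<Lambda>\<^sup>1\<^sup>/\<^sup>2\<close>, and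
  \<open>C\<^sub>\<Lambda> I = \<Lambda>\<close>.  Near \<open>\<Lambda>\<^sub>0\<close> with \<open>M(\<Lambda>\<^sub>0) = I\<close>, put \<open>\<Delta> = \<Lambda> - \<Lambda>\<^sub>0\<close>.  The difference of moments is
  exactly \<open>M(\<Lambda>) = I - H\<^sub>\<Lambda> \<Delta>\<close> with \<open>H\<^sub>\<Lambda> \<Delta> = \<integral> \<Psi> P (P \<bullet> \<Delta>) / ((P \<bullet> \<Lambda>) (P \<bullet> \<Lambda>\<^sub>0))\<close>, whence
  \<open>\<Theta>(\<Lambda>) - \<Lambda>\<^sub>0 = \<Delta> - C\<^sub>\<Lambda> (H\<^sub>\<Lambda> \<Delta>)\<close>.  Thus the square root never has to be differentiated: its
  continuity at \<open>\<Lambda>\<^sub>0\<close> is enough to compare with the linear map \<open>\<Delta> - C (H \<Delta>)\<close>, where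
  \<open>C = C\<^bsub>\<Lambda>\<^sub>0\<^esub>\<close> and \<open>H = H\<^bsub>\<Lambda>\<^sub>0\<^esub>\<close>.

  Distances are measured by the seminorm \<open>N(\<Delta>) = (H \<Delta> \<bullet> \<Delta>)\<^sup>1\<^sup>/\<^sup>2\<close>, the root mean square of the
  relative error \<open>(P \<bullet> \<Delta>) / (P \<bullet> \<Lambda>\<^sub>0)\<close>.  It vanishes in the directions along which the fixed points form
  an affine family, so that no projection onto that family is needed.  The heart of the matter is
  that \<open>N\<close> contracts strictly under \<open>\<Delta> - C (H \<Delta>)\<close> (\<open>preconditioned_step_contracts\<close>).  Both \<open>C\<close>
  and \<open>H\<close> are symmetric and positive; what has to be excluded are eigenvalues of \<open>C H\<close> above \<open>1\<close>.
  The map \<open>H C\<close> preserves positivity and fixes \<open>I\<close>, as \<open>H (C I) = H \<Lambda>\<^sub>0 = M(\<Lambda>\<^sub>0) = I\<close>, so its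
  powers are bounded (\<open>powers_bounded\<close>); and a symmetric operator with bounded powers does not
  increase the norm for which it is symmetric (\<open>symmetric_power_bounded_contraction\<close>).

  The error terms are at most a multiple of \<open>\<parallel>\<Delta>\<parallel> N(\<Delta>)\<close> (\<open>secant_bounds\<close>), so \<open>N\<close> also
  contracts under \<open>\<Theta>\<close> near \<open>\<Lambda>\<^sub>0\<close>, while the length of a step is at most a multiple of \<open>N(\<Delta>)\<close>.
  Every trajectory starting close to \<open>\<Lambda>\<^sub>0\<close> therefore has finite length, remains close to \<open>\<Lambda>\<^sub>0\<close> and
  converges to some \<open>\<Lambda>\<close> with \<open>N(\<Lambda> - \<Lambda>\<^sub>0) = 0\<close> (\<open>gauge_contraction_converges\<close>); there
  \<open>H\<^sub>\<Lambda> (\<Lambda> - \<Lambda>\<^sub>0) = 0\<close>, that is \<open>M(\<Lambda>) = I\<close>.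
\<close>

section \<open>Frobenius geometry of complex matrices\<close>

lemma inner_vector: "x \<bullet> y = Re (\<Sum>i\<in>UNIV. cnj (x $ i) * y $ i)"
  for x y :: "complex^'n"
  by (simp add: inner_vec_def inner_complex_def)

lemma inner_matrix: "X \<bullet> Y = Re (\<Sum>i\<in>UNIV. \<Sum>j\<in>UNIV. cnj (X $ i $ j) * Y $ i $ j)"
  for X Y :: "complex^'n^'m"
  by (simp add: inner_vec_def inner_complex_def)

lemma Re_cform: "Re (cform M x) = x \<bullet> (M *v x)"
  by (simp add: cform_def inner_vector)

lemma ctranspose_ctranspose [simp]: "ctranspose (ctranspose M) = M"
  by (simp add: ctranspose_def vec_eq_iff)

lemma ctranspose_mult: "ctranspose (X ** Y) = ctranspose Y ** ctranspose X"
  by (simp add: ctranspose_def matrix_matrix_mult_def vec_eq_iff mult.commute)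

lemma ctranspose_mat_1 [simp]: "ctranspose (mat 1) = mat 1"
  by (simp add: ctranspose_def vec_eq_iff mat_def)

lemma linear_ctranspose: "linear (ctranspose :: complex^'n^'m \<Rightarrow> complex^'m^'n)"
  by (rule linearI) (simp_all add: ctranspose_def vec_eq_iff)

lemma inner_ctranspose: "ctranspose X \<bullet> ctranspose Y = X \<bullet> Y"
  unfolding inner_matrix by (subst sum.swap) (simp add: ctranspose_def)

lemma inner_matrix_mult_right: "(X ** M) \<bullet> Y = X \<bullet> (Y ** ctranspose M)"
  for X :: "complex^'n^'m" and M :: "complex^'k^'n"
proof -
  have "(\<Sum>j\<in>UNIV. cnj ((X ** M) $ i $ j) * Y $ i $ j)
      = (\<Sum>k\<in>UNIV. cnj (X $ i $ k) * (Y ** ctranspose M) $ i $ k)" for i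
  proof -
    have "(\<Sum>j\<in>UNIV. cnj ((X ** M) $ i $ j) * Y $ i $ j)
        = (\<Sum>j\<in>UNIV. \<Sum>k\<in>UNIV. cnj (X $ i $ k) * (Y $ i $ j * cnj (M $ k $ j)))"
      by (simp add: matrix_matrix_mult_def sum_distrib_left sum_distrib_right mult_ac)
    also have "\<dots> = (\<Sum>k\<in>UNIV. \<Sum>j\<in>UNIV. cnj (X $ i $ k) * (Y $ i $ j * cnj (M $ k $ j)))"
      by (rule sum.swap)
    also have "\<dots> = (\<Sum>k\<in>UNIV. cnj (X $ i $ k) * (Y ** ctranspose M) $ i $ k)"
      by (simp add: matrix_matrix_mult_def sum_distrib_left ctranspose_def)
    finally show ?thesis .
  qed
  then show ?thesis by (simp only: inner_matrix)
qed

lemma inner_matrix_mult_left: "(M ** X) \<bullet> Y = X \<bullet> (ctranspose M ** Y)"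
  for X :: "complex^'m^'n" and M :: "complex^'n^'k"
proof -
  have "(M ** X) \<bullet> Y = (ctranspose X ** ctranspose M) \<bullet> ctranspose Y"
    by (simp add: inner_ctranspose flip: ctranspose_mult)
  also have "\<dots> = ctranspose X \<bullet> ctranspose (ctranspose M ** Y)"
    by (simp add: inner_matrix_mult_right ctranspose_mult)
  finally show ?thesis by (simp add: inner_ctranspose)
qed

lemma inner_matrix_vector_mult: "(M *v x) \<bullet> y = x \<bullet> (ctranspose M *v y)"
  for M :: "complex^'n^'k"
proof -
  have "(\<Sum>i\<in>UNIV. cnj ((M *v x) $ i) * y $ i)
      = (\<Sum>i\<in>UNIV. \<Sum>j\<in>UNIV. cnj (x $ j) * (cnj (M $ i $ j) * y $ i))"
    by (simp add: matrix_vector_mult_def sum_distrib_left sum_distrib_right mult_ac)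
  also have "\<dots> = (\<Sum>j\<in>UNIV. \<Sum>i\<in>UNIV. cnj (x $ j) * (cnj (M $ i $ j) * y $ i))"
    by (rule sum.swap)
  also have "\<dots> = (\<Sum>j\<in>UNIV. cnj (x $ j) * (ctranspose M *v y) $ j)"
    by (simp add: matrix_vector_mult_def sum_distrib_left ctranspose_def)
  finally show ?thesis by (simp only: inner_vector)
qed

lemma inner_mult_columns:
  "X \<bullet> (P ** X) = (\<Sum>j\<in>UNIV. column j X \<bullet> (P *v column j X))"
  for P :: "complex^'n^'n" and X :: "complex^'m^'n"
proof -
  have "X \<bullet> (P ** X) = Re (\<Sum>j\<in>UNIV. \<Sum>i\<in>UNIV. cnj (X $ i $ j) * (P ** X) $ i $ j)"
    unfolding inner_matrix by (subst sum.swap) (rule refl)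
  also have "\<dots> = (\<Sum>j\<in>UNIV. Re (\<Sum>i\<in>UNIV. cnj (column j X $ i) * (P *v column j X) $ i))"
    by (simp only: Re_sum) (simp add: matrix_vector_mult_def matrix_matrix_mult_def column_def)
  finally show ?thesis by (simp only: inner_vector)
qed

lemma inner_outer: "outer x \<bullet> Y = x \<bullet> (Y *v x)"
proof -
  have "(\<Sum>i\<in>UNIV. \<Sum>j\<in>UNIV. cnj (outer x $ i $ j) * Y $ i $ j)
      = (\<Sum>i\<in>UNIV. cnj (x $ i) * (Y *v x) $ i)"
    by (simp add: outer_def matrix_vector_mult_def sum_distrib_left mult_ac)
  then show ?thesis by (simp only: inner_matrix inner_vector)
qed

lemma outer_mult_vector: "outer x *v y = (\<Sum>j\<in>UNIV. cnj (x $ j) * y $ j) *s x"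
  by (simp add: outer_def matrix_vector_mult_def vec_eq_iff sum_distrib_left sum_distrib_right mult_ac)

lemma inner_outer_outer_nonneg: "0 \<le> outer x \<bullet> outer y"
proof -
  define c where "c = (\<Sum>j\<in>UNIV. cnj (y $ j) * x $ j)"
  have "outer x \<bullet> outer y = Re (\<Sum>i\<in>UNIV. cnj (x $ i) * (c * y $ i))"
    by (simp add: inner_outer outer_mult_vector c_def [symmetric] inner_vector)
  also have "(\<Sum>i\<in>UNIV. cnj (x $ i) * (c * y $ i)) = c * cnj c"
    by (simp add: c_def cnj_sum sum_distrib_left algebra_simps)
  also have "Re \<dots> \<ge> 0"
    by (simp add: complex_mult_cnj)
  finally show ?thesis .
qed

lemma hermitian_outer: "hermitian (outer x)"
  by (simp add: hermitian_def ctranspose_def outer_def vec_eq_iff)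

lemma mult_outer_mult:
  assumes "hermitian S" shows "S ** outer x ** S = outer (S *v x)"
proof -
  have S: "S $ i $ j = cnj (S $ j $ i)" for i j
    using assms by (metis (no_types, lifting) ctranspose_def hermitian_def vec_lambda_beta)
  have "(S ** outer x ** S) $ i $ j = outer (S *v x) $ i $ j" for i j
  proof -
    have "(S ** outer x ** S) $ i $ j
        = (\<Sum>k\<in>UNIV. (\<Sum>l\<in>UNIV. S $ i $ l * (x $ l * cnj (x $ k))) * cnj (S $ j $ k))"
      by (subst S[of j]) (simp add: matrix_matrix_mult_def outer_def)
    also have "\<dots> = outer (S *v x) $ i $ j"
      by (simp add: matrix_vector_mult_def outer_def sum_distrib_left sum_distrib_right algebra_simps)
    finally show ?thesis .
  qed
  then show ?thesis by (simp add: vec_eq_iff)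
qed

lemma bilinear_matrix_mult: "bilinear ((**) :: complex^'n^'m \<Rightarrow> complex^'k^'n \<Rightarrow> complex^'k^'m)"
  by (auto simp: bilinear_def matrix_matrix_mult_def vec_eq_iff sum.distrib algebra_simps
      scaleR_sum_right intro!: linearI)

lemma bounded_bilinear_matrix_mult:
  "bounded_bilinear ((**) :: complex^'n^'m \<Rightarrow> complex^'k^'n \<Rightarrow> complex^'k^'m)"
  using bilinear_matrix_mult bilinear_conv_bounded_bilinear by blast

lemma bounded_bilinear_matrix_vector_mult:
  "bounded_bilinear ((*v) :: complex^'n^'m \<Rightarrow> complex^'n \<Rightarrow> complex^'m)"
  unfolding bilinear_conv_bounded_bilinear[symmetric]
  by (auto simp: bilinear_def matrix_vector_mult_def vec_eq_iff sum.distrib algebra_simps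
      scaleR_sum_right intro!: linearI)

lemmas continuous_on_matrix_mult [continuous_intros] =
  bounded_bilinear.continuous_on[OF bounded_bilinear_matrix_mult]

lemmas continuous_on_matrix_vector_mult [continuous_intros] =
  bounded_bilinear.continuous_on[OF bounded_bilinear_matrix_vector_mult]

lemma continuous_on_outer [continuous_intros]:
  "continuous_on S f \<Longrightarrow> continuous_on S (\<lambda>z. outer (f z :: complex^'n))"
  unfolding outer_def by (intro continuous_intros continuous_on_vec_lambda) auto

lemma subspace_hermitian: "subspace {M :: complex^'n^'n. hermitian M}"
  unfolding hermitian_def
  by (simp add: subspace_def linear_0[OF linear_ctranspose] linear_add[OF linear_ctranspose]
      linear_cmul[OF linear_ctranspose])

lemma closed_hermitian: "closed {M :: complex^'n^'n. hermitian M}"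
  using subspace_hermitian by (rule closed_subspace)

lemma hermitian_sandwich:
  assumes "hermitian S" "hermitian X" shows "hermitian (S ** X ** S)"
  using assms by (simp add: hermitian_def ctranspose_mult matrix_mul_assoc)

section \<open>Positive definite matrices and their square roots\<close>

lemma posdef_iff: "posdef M \<longleftrightarrow> hermitian M \<and> (\<forall>x. x \<noteq> 0 \<longrightarrow> x \<bullet> (M *v x) > 0)"
  by (simp add: posdef_def Re_cform)

lemma possemidef_iff: "possemidef M \<longleftrightarrow> hermitian M \<and> (\<forall>x. x \<bullet> (M *v x) \<ge> 0)"
  by (simp add: possemidef_def Re_cform)

lemma posdef_coercive:
  fixes M :: "complex^'n^'n"
  assumes "posdef M"
  shows "\<exists>q>0. \<forall>x. q * (x \<bullet> x) \<le> x \<bullet> (M *v x)"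
proof -
  have "compact (sphere (0 :: complex^'n) 1)" "sphere (0 :: complex^'n) 1 \<noteq> {}"
    by auto
  moreover have "continuous_on (sphere 0 1) (\<lambda>x. x \<bullet> (M *v x))"
    by (intro continuous_intros)
  ultimately obtain u where u: "u \<in> sphere 0 1"
      "\<And>x. x \<in> sphere 0 1 \<Longrightarrow> u \<bullet> (M *v u) \<le> x \<bullet> (M *v x)"
    using continuous_attains_inf[of "sphere (0 :: complex^'n) 1" "\<lambda>x. x \<bullet> (M *v x)"] by blast
  interpret bounded_bilinear "(*v) :: complex^'n^'n \<Rightarrow> complex^'n \<Rightarrow> complex^'n"
    by (rule bounded_bilinear_matrix_vector_mult)
  show ?thesis
  proof (intro exI conjI allI)
    show "u \<bullet> (M *v u) > 0"
      using assms u(1) by (metis norm_zero posdef_iff mem_sphere_0 zero_neq_one)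
    fix x :: "complex^'n"
    show "(u \<bullet> (M *v u)) * (x \<bullet> x) \<le> x \<bullet> (M *v x)"
    proof (cases "x = 0")
      case False
      let ?y = "(1 / norm x) *\<^sub>R x"
      have "u \<bullet> (M *v u) \<le> ?y \<bullet> (M *v ?y)"
        using False by (intro u(2)) simp
      also have "\<dots> = (x \<bullet> (M *v x)) / (x \<bullet> x)"
        using False by (simp add: scaleR_right dot_square_norm power2_eq_square)
      finally show ?thesis using False by (simp add: field_simps)
    qed (simp add: zero_right)
  qed
qed

lemma inner_posdef_mult_ge:
  fixes X :: "complex^'n^'n"
  assumes "\<forall>x. q * (x \<bullet> x) \<le> x \<bullet> (P *v x)"
  shows "q * (X \<bullet> X) \<le> X \<bullet> (P ** X)"
proof -
  have "q * (X \<bullet> X) = (\<Sum>j\<in>UNIV. q * (column j X \<bullet> column j X))"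
    using inner_mult_columns[of X "mat 1"] by (simp add: sum_distrib_left)
  also have "\<dots> \<le> X \<bullet> (P ** X)"
    unfolding inner_mult_columns by (intro sum_mono assms[rule_format])
  finally show ?thesis .
qed

text \<open>Writing \<open>P\<^sup>2 - Q\<^sup>2 = P X + X Q\<close> with \<open>X = P - Q\<close> and pairing with \<open>X\<close> shows that the
  square root is unique and Lipschitz near \<open>Q\<^sup>2\<close>: both terms are nonnegative, and the second
  one is coercive.\<close>

lemma root_difference_bound:
  fixes P Q :: "complex^'n^'n"
  assumes P: "possemidef P" and Q: "hermitian Q" "\<forall>x. q * (x \<bullet> x) \<le> x \<bullet> (Q *v x)"
  shows "q * norm (P - Q) \<le> norm (P ** P - Q ** Q)"
proof -
  define X where "X = P - Q"
  have X: "ctranspose X = X"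
    using P Q by (simp add: X_def possemidef_iff hermitian_def linear_diff[OF linear_ctranspose])
  interpret bounded_bilinear "(**) :: complex^'n^'n \<Rightarrow> complex^'n^'n \<Rightarrow> complex^'n^'n"
    by (rule bounded_bilinear_matrix_mult)
  have "0 \<le> X \<bullet> (P ** X)"
    using inner_posdef_mult_ge[of 0 P X] P by (simp add: possemidef_iff)
  moreover have "q * (X \<bullet> X) \<le> X \<bullet> (X ** Q)"
  proof -
    have "X \<bullet> (X ** Q) = ctranspose X \<bullet> ctranspose (X ** Q)"
      by (simp only: inner_ctranspose)
    also have "\<dots> = X \<bullet> (Q ** X)"
      using X Q by (simp add: ctranspose_mult hermitian_def)
    finally show ?thesis using inner_posdef_mult_ge[OF Q(2), of X] by simp
  qed
  moreover have "P ** X + X ** Q = P ** P - Q ** Q"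
    by (simp add: X_def diff_left diff_right)
  ultimately have "q * (norm X)\<^sup>2 \<le> X \<bullet> (P ** P - Q ** Q)"
    by (metis add_increasing inner_add_right power2_norm_eq_inner)
  also have "\<dots> \<le> norm X * norm (P ** P - Q ** Q)"
    by (rule norm_cauchy_schwarz)
  finally show ?thesis
    unfolding X_def[symmetric] by (cases "X = 0") (auto simp: power2_eq_square)
qed

lemma posdef_imp_possemidef: "posdef M \<Longrightarrow> possemidef M"
  unfolding posdef_iff possemidef_iff
  by (metis inner_zero_left less_eq_real_def)

lemma square_inj:
  fixes P Q :: "complex^'n^'n"
  assumes "possemidef P" "posdef Q" "P ** P = Q ** Q"
  shows "P = Q"
proof -
  obtain q where "q > 0" "\<forall>x. q * (x \<bullet> x) \<le> x \<bullet> (Q *v x)"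
    using posdef_coercive[OF assms(2)] by blast
  then have "q * norm (P - Q) \<le> 0"
    using root_difference_bound[OF assms(1), of Q q] assms by (auto simp: posdef_def)
  then show ?thesis using \<open>q > 0\<close> by (simp add: mult_le_0_iff)
qed

lemma inner_square: "hermitian R \<Longrightarrow> x \<bullet> ((R ** R) *v x) = (R *v x) \<bullet> (R *v x)"
  by (simp add: inner_matrix_vector_mult hermitian_def matrix_vector_mul_assoc)

lemma hermitian_inner_commute: "hermitian M \<Longrightarrow> (M *v x) \<bullet> y = x \<bullet> (M *v y)"
  by (simp add: inner_matrix_vector_mult hermitian_def)

text \<open>A vector isotropic for a positive semidefinite \<open>R\<close> is killed by it, by the Cauchy--Schwarz
  inequality for the form of \<open>R\<close>.\<close>

lemma possemidef_root_posdef: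
  fixes R :: "complex^'n^'n"
  assumes R: "possemidef R" and "posdef (R ** R)"
  shows "posdef R"
proof -
  interpret bounded_bilinear "(*v) :: complex^'n^'n \<Rightarrow> complex^'n \<Rightarrow> complex^'n"
    by (rule bounded_bilinear_matrix_vector_mult)
  have h: "hermitian R" using R by (simp add: possemidef_iff)
  have "x \<bullet> (R *v x) > 0" if "x \<noteq> 0" for x
  proof (rule ccontr)
    assume "\<not> x \<bullet> (R *v x) > 0"
    then have x0: "x \<bullet> (R *v x) = 0" using R by (simp add: possemidef_iff order.antisym not_less)
    define y where "y = R *v x"
    define a where "a = y \<bullet> y"
    define b where "b = y \<bullet> (R *v y)"
    have b: "b \<ge> 0" using R by (simp add: b_def possemidef_iff)
    have a: "a > 0"
      using assms(2) that inner_square[OF h, of x] unfolding a_def y_def posdef_iff by metis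
    \<comment> \<open>The form at \<open>x - t R x\<close> is \<open>t (t b - 2 a)\<close>, negative for this \<open>t\<close>; the summand \<open>1\<close> covers
      \<open>b = 0\<close>.\<close>
    define t where "t = a / (b + 1)"
    have yx: "y \<bullet> (R *v x) = a" "x \<bullet> (R *v y) = a"
      using hermitian_inner_commute[OF h, of x y] by (simp_all add: a_def y_def)
    have "0 \<le> (x - t *\<^sub>R y) \<bullet> (R *v (x - t *\<^sub>R y))"
      using R by (simp add: possemidef_iff)
    also have "\<dots> = t\<^sup>2 * b - 2 * t * a"
      using x0 yx by (simp add: diff_right scaleR_right inner_diff_left inner_diff_right b_def
        power2_eq_square algebra_simps)
    also have "\<dots> = t * (t * b - 2 * a)" by (simp add: algebra_simps power2_eq_square)
    finally have "0 \<le> t * (t * b - 2 * a)" .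
    moreover have "t > 0" using a b by (simp add: t_def)
    moreover have "t * b \<le> a" using a b by (simp add: t_def field_simps)
    ultimately show False using a by (simp add: zero_le_mult_iff)
  qed
  then show ?thesis using h by (simp add: posdef_iff)
qed

lemma openin_posdef: "openin (top_of_set {M :: complex^'n^'n. hermitian M}) {M. posdef M}"
proof -
  interpret bounded_bilinear "(*v) :: complex^'n^'n \<Rightarrow> complex^'n \<Rightarrow> complex^'n"
    by (rule bounded_bilinear_matrix_vector_mult)
  obtain K where K: "K > 0" "\<forall>M x. norm ((M :: complex^'n^'n) *v x) \<le> norm M * norm x * K"
    using pos_bounded by blast
  have "\<exists>e>0. ball M e \<inter> {M. hermitian M} \<subseteq> {M. posdef M}" if M: "posdef M" for M :: "complex^'n^'n"
  proof -
    obtain q where q: "q > 0" "\<forall>x. q * (x \<bullet> x) \<le> x \<bullet> (M *v x)"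
      using posdef_coercive[OF M] by blast
    have "posdef M'" if M': "dist M M' < q / K" "hermitian M'" for M'
    proof -
      have "x \<bullet> (M' *v x) > 0" if "x \<noteq> 0" for x
      proof -
        have "\<bar>x \<bullet> ((M - M') *v x)\<bar> \<le> norm x * norm ((M - M') *v x)"
          by (rule Cauchy_Schwarz_ineq2)
        also have "\<dots> \<le> norm x * (norm (M - M') * norm x * K)"
          using K(2) by (intro mult_left_mono) auto
        also have "\<dots> = norm (M - M') * K * (norm x)\<^sup>2"
          by (simp add: power2_eq_square)
        also have "\<dots> < q * (norm x)\<^sup>2"
          using M'(1) that K(1) by (intro mult_strict_right_mono) (auto simp: dist_norm field_simps)
        also have "\<dots> \<le> x \<bullet> (M *v x)" using q(2)[rule_format, of x] by (simp add: power2_norm_eq_inner)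
        finally show ?thesis by (simp add: diff_left inner_diff_right)
      qed
      then show ?thesis using M' by (simp add: posdef_iff)
    qed
    then show ?thesis using q K by (intro exI[of _ "q / K"]) auto
  qed
  moreover have "{M. posdef M} \<subseteq> {M :: complex^'n^'n. hermitian M}"
    by (auto simp: posdef_def)
  ultimately show ?thesis
    unfolding openin_contains_ball by simp
qed

lemma convex_posdef: "convex {M :: complex^'n^'n. posdef M}"
proof (rule convexI)
  fix M M' :: "complex^'n^'n" and u v :: real
  assume *: "M \<in> {M. posdef M}" "M' \<in> {M. posdef M}" "0 \<le> u" "0 \<le> v" "u + v = 1"
  interpret bounded_bilinear "(*v) :: complex^'n^'n \<Rightarrow> complex^'n \<Rightarrow> complex^'n"
    by (rule bounded_bilinear_matrix_vector_mult)
  have "hermitian (u *\<^sub>R M + v *\<^sub>R M')"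
    using * subspace_hermitian unfolding posdef_def subspace_def by blast
  moreover have "x \<bullet> ((u *\<^sub>R M + v *\<^sub>R M') *v x) > 0" if "x \<noteq> 0" for x
  proof -
    have "x \<bullet> (M *v x) > 0" "x \<bullet> (M' *v x) > 0" using * that by (auto simp: posdef_iff)
    then have "u * (x \<bullet> (M *v x)) + v * (x \<bullet> (M' *v x)) > 0"
      using * by (cases "u = 0") (auto intro: add_pos_nonneg)
    then show ?thesis by (simp add: add_left scaleR_left inner_add_right)
  qed
  ultimately show "u *\<^sub>R M + v *\<^sub>R M' \<in> {M. posdef M}"
    by (simp add: posdef_iff)
qed

lemma square_posdef:
  assumes "posdef R" shows "posdef (R ** R)"
proof -
  have h: "hermitian R" using assms by (simp add: posdef_def)
  have "R *v x \<noteq> 0" if "x \<noteq> 0" for x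
    using assms that by (metis inner_zero_right less_irrefl posdef_iff)
  then show ?thesis
    using h by (auto simp: posdef_iff inner_square ctranspose_mult hermitian_def)
qed

lemma posdef_mat_1: "posdef (mat 1 :: complex^'n^'n)"
  by (simp add: posdef_iff hermitian_def)

text \<open>The squares of positive definite matrices form an open and closed subset of the convex
  set of positive definite matrices: open by invariance of domain, squaring being
  injective, and closed since \<open>\<parallel>R\<parallel>\<^sup>2 = tr R\<^sup>2\<close> makes the roots of a convergent sequence bounded.\<close>

lemma posdef_root_exists:
  fixes M :: "complex^'n^'n"
  assumes "posdef M"
  obtains R where "posdef R" "R ** R = M"
proof -
  let ?H = "{M :: complex^'n^'n. hermitian M}" and ?P = "{M :: complex^'n^'n. posdef M}"
  let ?f = "\<lambda>R :: complex^'n^'n. R ** R"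
  have PH: "?P \<subseteq> ?H" by (auto simp: posdef_def)
  have sub: "?f ` ?P \<subseteq> ?P" using square_posdef by auto
  have "openin (top_of_set ?H) (?f ` ?P)"
  proof (rule invariance_of_domain_subspaces)
    show "openin (top_of_set ?H) ?P" by (rule openin_posdef)
    show "?f \<in> ?P \<rightarrow> ?H" using sub PH by auto
    show "inj_on ?f ?P"
      using square_inj posdef_imp_possemidef by (auto intro!: inj_onI)
  qed (auto intro!: subspace_hermitian continuous_intros)
  then have op: "openin (top_of_set ?P) (?f ` ?P)"
    using PH sub openin_subset_trans by blast
  have "N \<in> ?f ` ?P" if N: "N \<in> ?P" and lim: "\<And>k. s k \<in> ?f ` ?P" "s \<longlonglongrightarrow> N" for N s
  proof -
    obtain R where R: "\<And>k. posdef (R k)" "\<And>k. s k = R k ** R k"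
      using lim(1) by (simp add: image_iff) metis
    have Rh: "hermitian (R k)" for k using R by (simp add: posdef_def)
    obtain b where b: "\<And>k. norm (s k) \<le> b"
      using convergent_imp_bounded[OF lim(2)] by (auto simp: bounded_iff)
    have "norm (R k) \<le> sqrt (norm (mat 1 :: complex^'n^'n) * b)" for k
    proof -
      have "(norm (R k))\<^sup>2 = (R k ** mat 1) \<bullet> R k" by (simp add: power2_norm_eq_inner)
      also have "\<dots> = mat 1 \<bullet> s k"
        using Rh[of k] by (simp add: inner_matrix_mult_left R hermitian_def del: matrix_mul_rid)
      also have "\<dots> \<le> norm (mat 1 :: complex^'n^'n) * b"
        by (meson b mult_left_mono norm_cauchy_schwarz norm_ge_zero order_trans)
      finally show ?thesis by (simp add: real_le_rsqrt)
    qed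
    then have "bounded (range R)" by (auto simp: bounded_iff)
    then obtain r l where r: "strict_mono r" "(R \<circ> r) \<longlonglongrightarrow> l"
      using bounded_imp_convergent_subsequence by blast
    have "(\<lambda>k. (R \<circ> r) k ** (R \<circ> r) k) \<longlonglongrightarrow> l ** l"
      by (intro bounded_bilinear.tendsto[OF bounded_bilinear_matrix_mult] r)
    moreover have "(\<lambda>k. (R \<circ> r) k ** (R \<circ> r) k) \<longlonglongrightarrow> N"
      using LIMSEQ_subseq_LIMSEQ[OF lim(2) r(1)] by (simp add: o_def R)
    ultimately have lN: "l ** l = N" using LIMSEQ_unique by blast
    have "hermitian l"
      using closed_sequentially[OF closed_hermitian, of "R \<circ> r" l] r Rh by simp
    moreover have "x \<bullet> (l *v x) \<ge> 0" for x
    proof (rule LIMSEQ_le_const)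
      show "(\<lambda>k. x \<bullet> ((R \<circ> r) k *v x)) \<longlonglongrightarrow> x \<bullet> (l *v x)"
        by (intro tendsto_inner tendsto_const r
            bounded_bilinear.tendsto[OF bounded_bilinear_matrix_vector_mult])
      show "\<exists>N. \<forall>n\<ge>N. 0 \<le> x \<bullet> ((R \<circ> r) n *v x)"
        using posdef_imp_possemidef[OF R(1)] by (simp add: possemidef_iff)
    qed
    ultimately have "posdef l"
      using possemidef_root_posdef N lN by (auto simp: possemidef_iff)
    then show ?thesis using lN by auto
  qed
  then have "closedin (top_of_set ?P) (?f ` ?P)"
    using sub unfolding closedin_limpt islimpt_sequential by blast
  then have eq: "?f ` ?P = ?P"
    using op convex_connected[OF convex_posdef] posdef_mat_1 unfolding connected_clopen by blast
  have "M \<in> ?f ` ?P" unfolding eq using assms by simp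
  then show thesis using that by (elim imageE) simp
qed

lemma msqrt:
  assumes "posdef M"
  shows posdef_msqrt: "posdef (msqrt M)" and msqrt_square: "msqrt M ** msqrt M = M"
proof -
  obtain R where R: "posdef R" "R ** R = M" using posdef_root_exists[OF assms] .
  have "msqrt M = R"
    unfolding msqrt_def
  proof (rule the_equality)
    show "possemidef R \<and> R ** R = M" using R posdef_imp_possemidef by auto
    show "S = R" if "possemidef S \<and> S ** S = M" for S
      using square_inj[of S R] R that by simp
  qed
  then show "posdef (msqrt M)" "msqrt M ** msqrt M = M" using R by auto
qed

lemma msqrt_lipschitz_at:
  fixes M :: "complex^'n^'n"
  assumes "posdef M"
  obtains c where "c > 0" "\<And>M'. posdef M' \<Longrightarrow> norm (msqrt M' - msqrt M) \<le> c * norm (M' - M)"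
proof -
  note root = posdef_msqrt[OF assms]
  obtain q where q: "q > 0" "\<forall>x. q * (x \<bullet> x) \<le> x \<bullet> (msqrt M *v x)"
    using posdef_coercive[OF root] by (elim exE conjE)
  have "norm (msqrt M' - msqrt M) \<le> (1 / q) * norm (M' - M)" if M': "posdef M'" for M'
  proof -
    have "hermitian (msqrt M)" using root by (simp add: posdef_def)
    then have "q * norm (msqrt M' - msqrt M) \<le> norm (M' - M)"
      using root_difference_bound[OF posdef_imp_possemidef[OF posdef_msqrt[OF M']] _ q(2)]
      unfolding msqrt_square[OF assms] msqrt_square[OF M'] by blast
    then show ?thesis using q by (simp add: field_simps)
  qed
  then show thesis using q that[of "1 / q"] by simp
qed

section \<open>Symmetric operators with bounded powers\<close>

lemma log_convex_bounded_imp_decrease: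
  fixes a :: "nat \<Rightarrow> real"
  assumes nonneg: "\<And>k. 0 \<le> a k" and convex: "\<And>k. (a (Suc k))\<^sup>2 \<le> a k * a (Suc (Suc k))"
    and bound: "\<And>k. a k \<le> b"
  shows "a 1 \<le> a 0"
proof (rule ccontr)
  assume less: "\<not> a 1 \<le> a 0"
  have a0: "a 0 > 0"
  proof (rule ccontr)
    assume "\<not> a 0 > 0"
    then have "a 0 = 0" using nonneg[of 0] by simp
    then show False using convex[of 0] less by simp
  qed
  define r where "r = a 1 / a 0"
  have r: "r > 1" using less a0 by (simp add: r_def)
  have step: "a k > 0 \<and> a (Suc k) \<ge> r * a k" for k
  proof (induction k)
    case 0
    then show ?case using a0 by (simp add: r_def)
  next
    case (Suc k)
    then have pos: "a (Suc k) > 0"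
      using r by (meson less_le_trans mult_pos_pos order.strict_trans zero_less_one)
    have "r * a k * a (Suc k) \<le> a (Suc k) * a (Suc k)"
      using Suc pos by (intro mult_right_mono) auto
    also have "\<dots> \<le> a k * a (Suc (Suc k))"
      using convex[of k] by (simp add: power2_eq_square)
    finally have "a k * (r * a (Suc k)) \<le> a k * a (Suc (Suc k))"
      by (simp add: mult_ac)
    then show ?case using Suc pos by (simp add: mult_le_cancel_left)
  qed
  have "r ^ k * a 0 \<le> a k" for k
  proof (induction k)
    case (Suc k)
    have "r ^ Suc k * a 0 = r * (r ^ k * a 0)" by simp
    also have "\<dots> \<le> r * a k" using Suc r by (intro mult_left_mono) auto
    also have "\<dots> \<le> a (Suc k)" using step[of k] by simp
    finally show ?case .
  qed simp
  moreover obtain k where "b / a 0 < r ^ k"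
    using real_arch_pow[OF r] by blast
  ultimately show False
    using bound[of k] a0 by (simp add: field_simps) (meson less_le_trans not_less)
qed

text \<open>The sequence \<open>\<parallel>E (T\<^sup>k u)\<parallel>\<close> is log-convex when \<open>T\<close> is symmetric for the form
  \<open>E u \<bullet> E v\<close>; boundedness then forces it to decrease.\<close>

lemma symmetric_power_bounded_contraction:
  fixes E :: "'a \<Rightarrow> 'b::real_inner" and T :: "'a \<Rightarrow> 'a"
  assumes sym: "\<And>u v. E (T u) \<bullet> E v = E u \<bullet> E (T v)"
    and bound: "\<And>k. norm (E ((T ^^ k) u)) \<le> b"
  shows "norm (E (T u)) \<le> norm (E u)"
proof -
  define a where "a k = norm (E ((T ^^ k) u))" for k
  have "(a (Suc k))\<^sup>2 \<le> a k * a (Suc (Suc k))" for k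
  proof -
    let ?w = "(T ^^ k) u"
    have "(a (Suc k))\<^sup>2 = E (T ?w) \<bullet> E (T ?w)" by (simp add: a_def power2_norm_eq_inner)
    also have "\<dots> = E ?w \<bullet> E (T (T ?w))" by (rule sym)
    also have "\<dots> \<le> a k * a (Suc (Suc k))"
      unfolding a_def by (simp add: norm_cauchy_schwarz)
    finally show ?thesis .
  qed
  then have "a 1 \<le> a 0"
    by (intro log_convex_bounded_imp_decrease[of a b]) (simp_all add: a_def bound)
  then show ?thesis by (simp add: a_def)
qed

text \<open>Only the component of \<open>x\<close> orthogonal to the kernel matters on both sides, and there \<open>H\<close>
  is bounded below.\<close>

lemma self_adjoint_form_le_norm_image:
  fixes H :: "'a::euclidean_space \<Rightarrow> 'a"
  assumes "linear H" and sym: "\<And>x y. H x \<bullet> y = x \<bullet> H y"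
  obtains c where "c > 0" "\<forall>x. H x \<bullet> x \<le> c * (norm (H x))\<^sup>2"
proof -
  interpret linear H by fact
  define K where "K = {x. H x = 0}"
  define S where "S = {x. \<forall>y\<in>K. orthogonal x y}"
  have K: "subspace K" by (auto simp: K_def subspace_def add scale zero)
  have S: "subspace S" by (auto simp: S_def subspace_def orthogonal_clauses)
  have "x = 0" if "x \<in> S" "H x = 0" for x
    using that by (auto simp: S_def K_def orthogonal_def)
  then obtain e where e: "e > 0" "\<forall>x\<in>S. e * norm x \<le> norm (H x)"
    using injective_imp_isometric[OF closed_subspace[OF S] S, of H] \<open>linear H\<close>
    by (auto simp: linear_conv_bounded_linear)
  have "H x \<bullet> x \<le> (1 / e) * (norm (H x))\<^sup>2" for x
  proof -
    obtain y z where yz: "y \<in> span K" "\<And>w. w \<in> span K \<Longrightarrow> orthogonal z w" "x = y + z"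
      using orthogonal_subspace_decomp_exists[of K x] by metis
    have y: "H y = 0" using yz(1) K by (simp add: span_eq_iff[THEN iffD2] K_def)
    have z: "z \<in> S" using yz(2) by (auto simp: S_def span_base)
    have "H x = H z" using y yz by (simp add: add)
    moreover have "H x \<bullet> x = H z \<bullet> z"
      using y yz sym[of z y] by (simp add: add inner_add_right)
    moreover have "H z \<bullet> z \<le> norm (H z) * norm z" by (rule norm_cauchy_schwarz)
    moreover have "\<dots> \<le> norm (H z) * (norm (H z) / e)"
      using e z by (intro mult_left_mono) (auto simp: field_simps)
    ultimately show ?thesis by (simp add: power2_eq_square)
  qed
  then show thesis using e(1) that[of "1 / e"] by simp
qed

text \<open>Expanding the form of \<open>H\<close> at \<open>x - C (H x)\<close> with \<open>u = H x\<close> gives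
  \<open>H x \<bullet> x - 2 \<parallel>E u\<parallel>\<^sup>2 + E (H (C u)) \<bullet> E u\<close>, and the last term is at most \<open>\<parallel>E u\<parallel>\<^sup>2\<close>
  because \<open>H \<circ> C\<close> is symmetric for the form of \<open>C\<close> and has bounded powers.  What is gained,
  \<open>\<parallel>E u\<parallel>\<^sup>2\<close>, is a fixed fraction of \<open>H x \<bullet> x\<close>.\<close>

lemma preconditioned_step_contracts:
  fixes H C E :: "'a::euclidean_space \<Rightarrow> 'a"
  assumes H: "linear H" "\<And>x y. H x \<bullet> y = x \<bullet> H y" "\<And>x. 0 \<le> H x \<bullet> x"
    and C: "linear C" "\<And>u v. C u \<bullet> v = E u \<bullet> E v"
    and E: "linear E" "inj E"
    and bound: "\<And>u. \<exists>b. \<forall>k. norm (((H \<circ> C) ^^ k) u) \<le> b"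
  obtains \<rho> where "0 \<le> \<rho>" "\<rho> < 1"
    "\<forall>x. H (x - C (H x)) \<bullet> (x - C (H x)) \<le> \<rho> * (H x \<bullet> x)"
proof -
  obtain c where c: "c > 0" "\<forall>x. H x \<bullet> x \<le> c * (norm (H x))\<^sup>2"
    using self_adjoint_form_le_norm_image[OF H(1,2)] .
  obtain q where q: "q > 0" "\<And>x. q * norm x \<le> norm (E x)"
    using linear_inj_bounded_below_pos[OF E] by metis
  have C_sym: "C u \<bullet> v = u \<bullet> C v" for u v
    using C(2)[of u v] C(2)[of v u] by (simp add: inner_commute)
  have E_le: "norm (E (H (C u))) \<le> norm (E u)" for u
  proof -
    obtain b where b: "\<forall>k. norm (((H \<circ> C) ^^ k) u) \<le> b" using bound by blast
    obtain K where K: "K > 0" "\<And>x. norm (E x) \<le> norm x * K"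
      using E(1) bounded_linear.pos_bounded by (metis linear_conv_bounded_linear)
    have "norm (E ((H \<circ> C) u)) \<le> norm (E u)"
    proof (rule symmetric_power_bounded_contraction[of E "H \<circ> C" u "b * K"])
      show "E ((H \<circ> C) v) \<bullet> E w = E v \<bullet> E ((H \<circ> C) w)" for v w
        using C_sym[of "H (C v)" w] H(2)[of "C v" "C w"] C(2)[of "H (C v)" w] C(2)[of v "H (C w)"]
        by simp
      show "norm (E (((H \<circ> C) ^^ k) u)) \<le> b * K" for k
        using K(2)[of "((H \<circ> C) ^^ k) u"] K(1) b by (meson mult_right_mono less_imp_le order_trans)
    qed
    then show ?thesis by simp
  qed
  define \<rho> where "\<rho> = max 0 (1 - q\<^sup>2 / c)"
  have "H (x - C (H x)) \<bullet> (x - C (H x)) \<le> \<rho> * (H x \<bullet> x)" for x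
  proof -
    let ?u = "H x"
    have "H (x - C ?u) \<bullet> (x - C ?u) = H x \<bullet> x - 2 * (C ?u \<bullet> ?u) + C (H (C ?u)) \<bullet> ?u"
      using H(2)[of "C ?u" x] C_sym[of "H (C ?u)" "?u"]
      by (simp add: linear_diff[OF H(1)] inner_diff_left inner_diff_right inner_commute)
    also have "\<dots> = H x \<bullet> x - 2 * (norm (E ?u))\<^sup>2 + E (H (C ?u)) \<bullet> E ?u"
      by (simp add: C(2) power2_norm_eq_inner)
    also have "E (H (C ?u)) \<bullet> E ?u \<le> (norm (E ?u))\<^sup>2"
      by (metis E_le mult_right_mono norm_cauchy_schwarz norm_ge_zero order_trans power2_eq_square)
    also have "H x \<bullet> x - 2 * (norm (E ?u))\<^sup>2 + (norm (E ?u))\<^sup>2 \<le> H x \<bullet> x - (q * norm ?u)\<^sup>2"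
      using power_mono[OF q(2)[of ?u], of 2] q(1) by simp
    also have "\<dots> \<le> H x \<bullet> x - q\<^sup>2 / c * (H x \<bullet> x)"
    proof -
      have "q\<^sup>2 / c * (H x \<bullet> x) \<le> q\<^sup>2 / c * (c * (norm (H x))\<^sup>2)"
        using c q(1) by (intro mult_left_mono) auto
      then show ?thesis using c(1) by (simp add: power_mult_distrib)
    qed
    also have "\<dots> = (1 - q\<^sup>2 / c) * (H x \<bullet> x)" by (simp add: algebra_simps)
    also have "\<dots> \<le> \<rho> * (H x \<bullet> x)"
      using H(3) by (intro mult_right_mono) (auto simp: \<rho>_def)
    finally show ?thesis by simp
  qed
  moreover have "0 \<le> \<rho>" "\<rho> < 1" using c(1) q(1) by (auto simp: \<rho>_def)
  ultimately show thesis using that by blast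
qed

section \<open>Convergence towards a set of fixed points\<close>

text \<open>The gauge \<open>N\<close> may vanish on a whole set through \<open>x0\<close>.  Since it decreases geometrically
  and controls the length of the steps, the total displacement is small, so that the trajectory
  stays near \<open>x0\<close> and converges to a zero of \<open>N\<close>.\<close>

lemma gauge_contraction_converges:
  fixes F :: "'a::banach \<Rightarrow> 'a" and N :: "'a \<Rightarrow> real"
  assumes r: "r > 0" and \<rho>: "0 \<le> \<rho>" "\<rho> < 1" and K: "K \<ge> 0" and U: "closed U"
    and N0: "\<And>x. 0 \<le> N x" and c: "\<And>x. N x \<le> c * dist x x0" and contN: "continuous_on UNIV N"
    and N_step: "\<And>x. x \<in> U \<Longrightarrow> dist x x0 \<le> r \<Longrightarrow> N (F x) \<le> \<rho> * N x"
    and step: "\<And>x. x \<in> U \<Longrightarrow> dist x x0 \<le> r \<Longrightarrow> dist (F x) x \<le> K * N x"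
    and FU: "\<And>x. x \<in> U \<Longrightarrow> dist x x0 \<le> r \<Longrightarrow> F x \<in> U"
  obtains \<delta> where "0 < \<delta>" "\<delta> \<le> r"
    "\<forall>y. y 0 \<in> U \<longrightarrow> dist (y 0) x0 < \<delta> \<longrightarrow> (\<forall>k. y (Suc k) = F (y k)) \<longrightarrow>
       (\<exists>l\<in>U. dist l x0 \<le> r \<and> N l = 0 \<and> y \<longlonglongrightarrow> l)"
proof -
  define c' where "c' = max c 0"
  have c': "N x \<le> c' * dist x x0" for x
    using c[of x] mult_right_mono[of c c' "dist x x0"] by (simp add: c'_def)
  \<comment> \<open>The first step is at most \<open>K c' \<delta>\<close> long and the steps decay like \<open>\<rho>\<^sup>k\<close>, so a trajectory
    stays within \<open>\<delta> D\<close> of \<open>x0\<close>.\<close>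
  define D where "D = 1 + K * c' / (1 - \<rho>)"
  have D: "D \<ge> 1" using K \<rho> by (simp add: D_def c'_def)
  define \<delta> where "\<delta> = r / D"
  have "\<exists>l\<in>U. dist l x0 \<le> r \<and> N l = 0 \<and> y \<longlonglongrightarrow> l"
    if y: "y 0 \<in> U" "dist (y 0) x0 < \<delta>" "\<forall>k. y (Suc k) = F (y k)" for y
  proof -
    define a where "a = N (y 0)"
    have a: "0 \<le> a" "a \<le> c' * \<delta>"
      using N0 c'[of "y 0"] y(2) mult_left_mono[of "dist (y 0) x0" \<delta> c']
      by (auto simp: a_def c'_def)
    have geom: "(\<Sum>i<k. \<rho> ^ i) \<le> 1 / (1 - \<rho>)" for k
      using sum_le_suminf[of "\<lambda>i. \<rho> ^ i" "{..<k}"] \<rho> by (simp add: suminf_geometric)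
    have *: "y k \<in> U \<and> N (y k) \<le> \<rho> ^ k * a \<and> dist (y k) x0 \<le> \<delta> + K * a * (\<Sum>i<k. \<rho> ^ i)" for k
    proof (induction k)
      case 0
      then show ?case using y by (simp add: a_def)
    next
      case (Suc k)
      have "K * a * (\<Sum>i<k. \<rho> ^ i) \<le> K * (c' * \<delta>) * (1 / (1 - \<rho>))"
        using geom[of k] a K \<rho> by (intro mult_mono) (auto intro!: sum_nonneg)
      then have "\<delta> + K * a * (\<Sum>i<k. \<rho> ^ i) \<le> \<delta> * D"
        by (simp add: D_def algebra_simps)
      also have "\<delta> * D = r" using D by (simp add: \<delta>_def)
      finally have near: "dist (y k) x0 \<le> r" using Suc by simp
      have "N (y (Suc k)) \<le> \<rho> * N (y k)" using N_step Suc near y(3) by simp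
      also have "\<dots> \<le> \<rho> * (\<rho> ^ k * a)" using Suc \<rho> by (intro mult_left_mono) auto
      finally have "N (y (Suc k)) \<le> \<rho> ^ Suc k * a" by simp
      moreover have "dist (y (Suc k)) x0 \<le> \<delta> + K * a * (\<Sum>i<Suc k. \<rho> ^ i)"
      proof -
        have "dist (y (Suc k)) (y k) \<le> K * N (y k)" using step Suc near y(3) by simp
        also have "\<dots> \<le> K * (\<rho> ^ k * a)" using Suc K by (intro mult_left_mono) auto
        finally show ?thesis
          using Suc dist_triangle[of "y (Suc k)" x0 "y k"] by (simp add: algebra_simps)
      qed
      ultimately show ?case using FU Suc near y(3) by simp
    qed
    have near: "dist (y k) x0 \<le> r" for k
    proof -
      have "K * a * (\<Sum>i<k. \<rho> ^ i) \<le> K * (c' * \<delta>) * (1 / (1 - \<rho>))"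
        using geom[of k] a K \<rho> by (intro mult_mono) (auto intro!: sum_nonneg)
      then have "\<delta> + K * a * (\<Sum>i<k. \<rho> ^ i) \<le> \<delta> * D"
        by (simp add: D_def algebra_simps)
      also have "\<delta> * D = r" using D by (simp add: \<delta>_def)
      finally show ?thesis using * [of k] by simp
    qed
    have "summable (\<lambda>k. y (Suc k) - y k)"
    proof (rule summable_comparison_test')
      show "summable (\<lambda>k. K * a * \<rho> ^ k)" using \<rho> by (intro summable_mult summable_geometric) simp
      show "norm (y (Suc k) - y k) \<le> K * a * \<rho> ^ k" for k
      proof -
        have "norm (y (Suc k) - y k) \<le> K * N (y k)"
          using step[of "y k"] * [of k] near y(3) by (simp add: dist_norm)
        also have "\<dots> \<le> K * (\<rho> ^ k * a)" using * [of k] K by (intro mult_left_mono) auto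
        finally show ?thesis by (simp add: mult_ac)
      qed
    qed
    then have "convergent (\<lambda>n. y n - y 0)"
      by (simp add: summable_iff_convergent sum_lessThan_telescope)
    then obtain l' where "(\<lambda>n. y n - y 0) \<longlonglongrightarrow> l'" by (auto simp: convergent_def)
    from tendsto_add[OF this tendsto_const[of "y 0"]] obtain l where l: "y \<longlonglongrightarrow> l"
      by simp
    have "l \<in> U" using closed_sequentially[OF U _ l] * by blast
    moreover have "dist l x0 \<le> r"
      using closed_sequentially[OF closed_cball[of x0 r] _ l] near by (simp add: dist_commute)
    moreover have "N l = 0"
    proof (rule LIMSEQ_unique)
      show "(\<lambda>k. N (y k)) \<longlonglongrightarrow> N l"
        using contN l by (simp add: continuous_on_eq_continuous_at isCont_tendsto_compose)
      show "(\<lambda>k. N (y k)) \<longlonglongrightarrow> 0"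
      proof (rule tendsto_sandwich[OF _ _ tendsto_const])
        show "(\<lambda>k. \<rho> ^ k * a) \<longlonglongrightarrow> 0"
          using \<rho> by (intro tendsto_mult_left_zero LIMSEQ_power_zero) auto
      qed (use N0 * in auto)
    qed
    ultimately show ?thesis using l by blast
  qed
  moreover have "0 < \<delta>" "\<delta> \<le> r" using r D by (simp_all add: \<delta>_def field_simps)
  ultimately show thesis using that[of \<delta>] by blast
qed

section \<open>Means over the unit circle\<close>

lemma circle_integrable:
  fixes f :: "complex \<Rightarrow> 'b::euclidean_space"
  assumes "continuous_on unit_circle f"
  shows "(\<lambda>t. f (cis t)) integrable_on {-pi..pi}"
proof (rule integrable_continuous_interval)
  have "continuous_on {-pi..pi} (f \<circ> cis)"
    by (rule continuous_on_compose) (auto intro!: continuous_intros continuous_on_subset[OF assms])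
  then show "continuous_on {-pi..pi} (\<lambda>t. f (cis t))" by (simp add: o_def)
qed

lemma circle_mean_cong: "(\<And>z. z \<in> unit_circle \<Longrightarrow> f z = g z) \<Longrightarrow> circle_mean f = circle_mean g"
  unfolding circle_mean_def by (intro arg_cong[where f = "scaleR _"] integral_cong) simp

lemma circle_mean_linear:
  fixes f :: "complex \<Rightarrow> 'b::euclidean_space" and T :: "'b \<Rightarrow> 'c::euclidean_space"
  assumes "continuous_on unit_circle f" "linear T"
  shows "T (circle_mean f) = circle_mean (\<lambda>z. T (f z))"
  using integral_linear[OF circle_integrable[OF assms(1)], of T] assms(2)
  by (simp add: circle_mean_def linear_cmul o_def linear_conv_bounded_linear)

lemma circle_mean_add:
  fixes f :: "complex \<Rightarrow> 'b::euclidean_space"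
  assumes "continuous_on unit_circle f" "continuous_on unit_circle g"
  shows "circle_mean (\<lambda>z. f z + g z) = circle_mean f + circle_mean g"
  by (simp add: circle_mean_def integral_add circle_integrable assms scaleR_add_right)

lemma circle_mean_scaleR: "circle_mean (\<lambda>z. c *\<^sub>R f z) = c *\<^sub>R circle_mean f"
  by (simp add: circle_mean_def)

lemma circle_mean_mult_left: "circle_mean (\<lambda>z. c * f z) = c * circle_mean f" for c :: real
  using circle_mean_scaleR[of c f] by simp

lemma circle_mean_norm_le:
  fixes f :: "complex \<Rightarrow> 'b::euclidean_space"
  assumes "continuous_on unit_circle f" "continuous_on unit_circle g"
    "\<And>z. z \<in> unit_circle \<Longrightarrow> norm (f z) \<le> g z"
  shows "norm (circle_mean f) \<le> circle_mean g"
proof -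
  have "norm (integral {-pi..pi} (\<lambda>t. f (cis t))) \<le> integral {-pi..pi} (\<lambda>t. g (cis t))"
    by (rule integral_norm_bound_integral) (auto intro!: circle_integrable assms)
  then show ?thesis by (simp add: circle_mean_def divide_right_mono)
qed

lemma circle_mean_nonneg:
  fixes f :: "complex \<Rightarrow> real"
  assumes "continuous_on unit_circle f" "\<And>z. z \<in> unit_circle \<Longrightarrow> 0 \<le> f z"
  shows "0 \<le> circle_mean f"
  using circle_mean_norm_le[of "\<lambda>z. 0 :: real" f] assms by (simp add: circle_mean_def)

text \<open>By Jensen's inequality for the probability weight \<open>\<Psi>\<close>, the mean of \<open>\<bar>f\<bar>\<close> is at most the
  root mean square of \<open>f\<close>.\<close>

lemma circle_mean_norm_le_root:
  fixes f :: "complex \<Rightarrow> real" and g :: "complex \<Rightarrow> 'b::euclidean_space"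
  assumes Psi: "\<Psi> \<in> Cplus" "circle_mean \<Psi> = 1"
    and f: "continuous_on unit_circle f" and g: "continuous_on unit_circle g"
    and b: "\<And>z. z \<in> unit_circle \<Longrightarrow> norm (g z) \<le> b"
  shows "norm (circle_mean (\<lambda>z. (\<Psi> z * f z) *\<^sub>R g z)) \<le> b * sqrt (circle_mean (\<lambda>z. \<Psi> z * (f z)\<^sup>2))"
proof -
  have c: "continuous_on unit_circle \<Psi>" and pos: "\<And>z. z \<in> unit_circle \<Longrightarrow> 0 < \<Psi> z"
    using Psi by (auto simp: Cplus_def)
  have b0: "b \<ge> 0" using b[of 1] norm_ge_zero[of "g 1"] by (simp del: norm_ge_zero)
  define m where "m = circle_mean (\<lambda>z. \<Psi> z * \<bar>f z\<bar>)"
  have m: "0 \<le> m"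
    unfolding m_def by (intro circle_mean_nonneg continuous_intros c f) (simp add: pos less_imp_le)
  have "norm (circle_mean (\<lambda>z. (\<Psi> z * f z) *\<^sub>R g z)) \<le> circle_mean (\<lambda>z. b * (\<Psi> z * \<bar>f z\<bar>))"
  proof (rule circle_mean_norm_le)
    fix z :: complex assume "z \<in> unit_circle"
    then have "norm ((\<Psi> z * f z) *\<^sub>R g z) = \<Psi> z * \<bar>f z\<bar> * norm (g z)"
      and "\<Psi> z * \<bar>f z\<bar> \<ge> 0"
      using pos[of z] by (simp_all add: abs_mult)
    then show "norm ((\<Psi> z * f z) *\<^sub>R g z) \<le> b * (\<Psi> z * \<bar>f z\<bar>)"
      using mult_left_mono[OF b[OF \<open>z \<in> unit_circle\<close>], of "\<Psi> z * \<bar>f z\<bar>"]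
      by (simp only: mult_ac)
  qed (intro continuous_intros c f g)+
  also have "\<dots> = b * m" by (simp add: circle_mean_mult_left m_def)
  finally have "norm (circle_mean (\<lambda>z. (\<Psi> z * f z) *\<^sub>R g z)) \<le> b * m" .
  moreover have "m\<^sup>2 \<le> circle_mean (\<lambda>z. \<Psi> z * (f z)\<^sup>2)"
  proof -
    have "0 \<le> circle_mean (\<lambda>z. \<Psi> z * (\<bar>f z\<bar> - m)\<^sup>2)"
      by (intro circle_mean_nonneg continuous_intros c f) (simp add: pos less_imp_le)
    also have "\<dots> = circle_mean (\<lambda>z. \<Psi> z * (f z)\<^sup>2 + ((- (2 * m)) * (\<Psi> z * \<bar>f z\<bar>) + m\<^sup>2 * \<Psi> z))"
      by (rule circle_mean_cong) (simp add: power2_diff algebra_simps)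
    also have "\<dots> = circle_mean (\<lambda>z. \<Psi> z * (f z)\<^sup>2)
        + ((- (2 * m)) * circle_mean (\<lambda>z. \<Psi> z * \<bar>f z\<bar>) + m\<^sup>2 * circle_mean \<Psi>)"
      unfolding circle_mean_mult_left[symmetric]
      by (simp only: circle_mean_add continuous_intros c f)
    also have "\<dots> = circle_mean (\<lambda>z. \<Psi> z * (f z)\<^sup>2) - m\<^sup>2"
      by (simp add: Psi power2_eq_square flip: m_def)
    finally show ?thesis by simp
  qed
  then have "m \<le> sqrt (circle_mean (\<lambda>z. \<Psi> z * (f z)\<^sup>2))" by (rule real_le_rsqrt)
  ultimately show ?thesis using mult_left_mono b0 order_trans by blast
qed

section \<open>The iteration driven by a mean over the circle\<close>

text \<open>The argument sees the matrices only as vectors of a Euclidean space: \<open>P z\<close> stands for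
  \<open>G(z) G(z)\<^sup>*\<close>, \<open>x0\<close> for a positive definite fixed point, and \<open>e\<close> for the identity matrix.\<close>

locale circle_iteration =
  fixes \<Psi> :: "complex \<Rightarrow> real" and P :: "complex \<Rightarrow> 'a::euclidean_space" and x0 e :: 'a
  assumes Psi: "\<Psi> \<in> Cplus" and Psi_mean: "circle_mean \<Psi> = 1"
    and P: "continuous_on unit_circle P"
    and pos: "\<And>z. z \<in> unit_circle \<Longrightarrow> 0 < P z \<bullet> x0"
    and balanced: "circle_mean (\<lambda>z. (\<Psi> z / (P z \<bullet> x0)) *\<^sub>R P z) = e"
begin

definition moment :: "'a \<Rightarrow> 'a" where
  "moment x = circle_mean (\<lambda>z. (\<Psi> z / (P z \<bullet> x)) *\<^sub>R P z)"

text \<open>At \<open>d = x - x0\<close> this is exactly \<open>moment x0 - moment x\<close>; for \<open>x = x0\<close> it is the Hessian,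
  applied to \<open>d\<close>, at \<open>x0\<close> of \<open>x \<mapsto> e \<bullet> x - \<integral>\<Psi> log (P \<bullet> x)\<close>.\<close>

definition secant :: "'a \<Rightarrow> 'a \<Rightarrow> 'a" where
  "secant x d = circle_mean (\<lambda>z. (\<Psi> z * ((P z \<bullet> d) / (P z \<bullet> x0))) *\<^sub>R ((1 / (P z \<bullet> x)) *\<^sub>R P z))"

abbreviation hess :: "'a \<Rightarrow> 'a" where
  "hess \<equiv> secant x0"

definition hess_norm :: "'a \<Rightarrow> real" where
  "hess_norm d = sqrt (hess d \<bullet> d)"

lemma Psi_cont: "continuous_on unit_circle \<Psi>" and Psi_pos: "z \<in> unit_circle \<Longrightarrow> 0 < \<Psi> z"
  using Psi by (auto simp: Cplus_def)

lemmas cont = Psi_cont P continuous_intros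

lemma pos_nz: "z \<in> unit_circle \<Longrightarrow> P z \<bullet> x0 \<noteq> 0"
  using pos by fastforce

lemma cont_secant_integrand:
  assumes "\<And>z. z \<in> unit_circle \<Longrightarrow> 0 < P z \<bullet> x"
  shows "continuous_on unit_circle
    (\<lambda>z. (\<Psi> z * ((P z \<bullet> d) / (P z \<bullet> x0))) *\<^sub>R ((1 / (P z \<bullet> x)) *\<^sub>R P z))"
  using assms pos_nz by (intro cont) (auto simp: less_le)

lemma moment_eq:
  assumes x: "\<And>z. z \<in> unit_circle \<Longrightarrow> 0 < P z \<bullet> x"
  shows "moment x = e - secant x (x - x0)"
proof -
  have "moment x + secant x (x - x0)
      = circle_mean (\<lambda>z. (\<Psi> z / (P z \<bullet> x)) *\<^sub>R P z
          + (\<Psi> z * ((P z \<bullet> (x - x0)) / (P z \<bullet> x0))) *\<^sub>R ((1 / (P z \<bullet> x)) *\<^sub>R P z))"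
    unfolding moment_def secant_def
  proof (rule circle_mean_add[symmetric])
    show "continuous_on unit_circle (\<lambda>z. (\<Psi> z / (P z \<bullet> x)) *\<^sub>R P z)"
      using x by (intro cont) (auto simp: less_le)
  qed (rule cont_secant_integrand[OF x])
  also have "\<dots> = circle_mean (\<lambda>z. (\<Psi> z / (P z \<bullet> x0)) *\<^sub>R P z)"
  proof (rule circle_mean_cong)
    fix z :: complex assume z: "z \<in> unit_circle"
    have "\<Psi> z / (P z \<bullet> x) + \<Psi> z * ((P z \<bullet> (x - x0)) / (P z \<bullet> x0)) * (1 / (P z \<bullet> x))
        = \<Psi> z / (P z \<bullet> x0)"
      using x[OF z] pos[OF z] by (simp add: inner_diff_right field_simps)
    then show "(\<Psi> z / (P z \<bullet> x)) *\<^sub>R P z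
          + (\<Psi> z * ((P z \<bullet> (x - x0)) / (P z \<bullet> x0))) *\<^sub>R ((1 / (P z \<bullet> x)) *\<^sub>R P z)
        = (\<Psi> z / (P z \<bullet> x0)) *\<^sub>R P z"
      by (simp only: scaleR_scaleR flip: scaleR_add_left)
  qed
  finally show ?thesis using balanced by (simp add: algebra_simps)
qed

lemma inner_hess:
  "hess u \<bullet> v = circle_mean (\<lambda>z. \<Psi> z * ((P z \<bullet> u) / (P z \<bullet> x0)) * ((P z \<bullet> v) / (P z \<bullet> x0)))"
proof -
  have "linear (\<lambda>w. w \<bullet> v)" by (intro bounded_linear.linear bounded_linear_inner_left)
  from circle_mean_linear[OF cont_secant_integrand[OF pos] this, of u]
  show ?thesis by (simp add: secant_def)
qed

lemma hess_sym: "hess u \<bullet> v = u \<bullet> hess v"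
  unfolding inner_commute[of u] inner_hess by (simp add: mult_ac)

lemma linear_hess: "linear hess"
proof -
  have "hess (u + v) \<bullet> w = (hess u + hess v) \<bullet> w" for u v w
    by (simp add: hess_sym inner_add_left)
  moreover have "hess (c *\<^sub>R u) \<bullet> w = (c *\<^sub>R hess u) \<bullet> w" for c u w
    by (simp add: hess_sym)
  ultimately show ?thesis by (intro linearI) (blast intro: vector_eq_rdot[THEN iffD1])+
qed

lemma hess_form: "hess d \<bullet> d = circle_mean (\<lambda>z. \<Psi> z * ((P z \<bullet> d) / (P z \<bullet> x0))\<^sup>2)"
  by (simp add: inner_hess power2_eq_square mult_ac)

lemma hess_norm_eq: "hess_norm d = sqrt (circle_mean (\<lambda>z. \<Psi> z * ((P z \<bullet> d) / (P z \<bullet> x0))\<^sup>2))"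
  by (simp add: hess_norm_def hess_form)

lemma hess_nonneg: "0 \<le> hess d \<bullet> d"
  unfolding hess_form using pos_nz
  by (intro circle_mean_nonneg cont) (auto simp: Psi_pos less_imp_le)

lemma hess_norm_nonneg: "0 \<le> hess_norm d"
  by (simp add: hess_norm_def hess_nonneg)

lemma hess_norm_square: "(hess_norm d)\<^sup>2 = hess d \<bullet> d"
  by (simp add: hess_norm_def hess_nonneg)

lemma hess_norm_le_norm: obtains c where "c > 0" "\<forall>d. hess_norm d \<le> c * norm d"
proof -
  obtain K where K: "K > 0" "\<And>d. norm (hess d) \<le> norm d * K"
    using linear_hess bounded_linear.pos_bounded by (metis linear_conv_bounded_linear)
  have "hess_norm d \<le> sqrt K * norm d" for d
  proof -
    have "hess d \<bullet> d \<le> norm (hess d) * norm d" by (rule norm_cauchy_schwarz)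
    also have "\<dots> \<le> norm d * K * norm d" by (intro mult_right_mono K) auto
    finally have "hess_norm d \<le> sqrt (K * (norm d)\<^sup>2)"
      by (simp add: hess_norm_def power2_eq_square mult_ac)
    then show ?thesis by (simp add: real_sqrt_mult)
  qed
  then show thesis using that[of "sqrt K"] K by simp
qed

lemma hess_norm_cont: "continuous_on UNIV (\<lambda>x. hess_norm (x - x0))"
proof -
  have "continuous_on UNIV hess"
    by (intro linear_continuous_on) (simp add: linear_hess flip: linear_conv_bounded_linear)
  then have "continuous_on UNIV (\<lambda>x. hess (x - x0))"
    by (rule continuous_on_compose2) (auto intro!: continuous_intros)
  then show ?thesis unfolding hess_norm_def by (intro continuous_intros)
qed

text \<open>A weighted triangle inequality for squares, from positivity of the form at
  \<open>\<epsilon> a - b\<close>.\<close>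

lemma hess_norm_add_le:
  assumes "\<epsilon> > 0"
  shows "(hess_norm (a + b))\<^sup>2 \<le> (1 + \<epsilon>) * (hess_norm a)\<^sup>2 + (1 + 1 / \<epsilon>) * (hess_norm b)\<^sup>2"
proof -
  interpret linear hess by (rule linear_hess)
  have ba: "hess b \<bullet> a = hess a \<bullet> b" by (metis hess_sym inner_commute)
  have "0 \<le> hess (\<epsilon> *\<^sub>R a - b) \<bullet> (\<epsilon> *\<^sub>R a - b)" by (rule hess_nonneg)
  also have "\<dots> = \<epsilon>\<^sup>2 * (hess a \<bullet> a) - 2 * \<epsilon> * (hess a \<bullet> b) + hess b \<bullet> b"
    by (simp add: diff scale inner_diff_left inner_diff_right ba power2_eq_square algebra_simps)
  finally have "2 * (hess a \<bullet> b) \<le> \<epsilon> * (hess a \<bullet> a) + (1 / \<epsilon>) * (hess b \<bullet> b)"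
    using assms by (simp add: field_simps power2_eq_square)
  then show ?thesis
    by (simp add: hess_norm_square add inner_add_left inner_add_right ba algebra_simps)
qed

lemma P_bounds:
  obtains m b where "0 < m" "0 < b" "\<forall>z\<in>unit_circle. m \<le> P z \<bullet> x0" "\<forall>z\<in>unit_circle. norm (P z) \<le> b"
proof -
  have ne: "unit_circle \<noteq> {}" "compact unit_circle" by auto
  have "continuous_on unit_circle (\<lambda>z. P z \<bullet> x0)" "continuous_on unit_circle (\<lambda>z. norm (P z))"
    by (intro cont)+
  from continuous_attains_inf[OF ne(2,1) this(1)] continuous_attains_sup[OF ne(2,1) this(2)]
  obtain u v where u: "u \<in> unit_circle" "\<forall>z\<in>unit_circle. P u \<bullet> x0 \<le> P z \<bullet> x0"
    and v: "v \<in> unit_circle" "\<forall>z\<in>unit_circle. norm (P z) \<le> norm (P v)"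
    by blast
  have "P v \<noteq> 0" using pos_nz[OF v(1)] by auto
  then show thesis using that[of "P u \<bullet> x0" "norm (P v)"] u v pos by simp
qed

text \<open>Near \<open>x0\<close> the denominators stay away from zero, and the secant depends on \<open>d\<close> only through
  the ratios \<open>P \<bullet> d / P \<bullet> x0\<close>, whose mean square is \<open>(hess_norm d)\<^sup>2\<close>.\<close>

lemma secant_bounds:
  obtains r K where "0 < r" "0 < K"
    "\<forall>x d. dist x x0 \<le> r \<longrightarrow> (\<forall>z\<in>unit_circle. 0 < P z \<bullet> x) \<and> norm (secant x d) \<le> K * hess_norm d \<and>
       norm (hess d - secant x d) \<le> K * dist x x0 * hess_norm d"
proof -
  obtain m b where mb: "0 < m" "0 < b" "\<forall>z\<in>unit_circle. m \<le> P z \<bullet> x0" "\<forall>z\<in>unit_circle. norm (P z) \<le> b"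
    by (rule P_bounds)
  define r where "r = m / (2 * b)"
  define K where "K = max (2 * b / m) (2 * b\<^sup>2 / m\<^sup>2)"
  have r: "r > 0" and K: "K > 0" using mb by (simp_all add: r_def K_def less_max_iff_disj)
  have "(\<forall>z\<in>unit_circle. 0 < P z \<bullet> x) \<and> norm (secant x d) \<le> K * hess_norm d \<and>
       norm (hess d - secant x d) \<le> K * dist x x0 * hess_norm d" if x: "dist x x0 \<le> r" for x d
  proof -
    have near: "\<bar>P z \<bullet> (x - x0)\<bar> \<le> b * dist x x0" if "z \<in> unit_circle" for z
      using Cauchy_Schwarz_ineq2[of "P z" "x - x0"] mb(4) that
      by (metis dist_norm mult_right_mono norm_ge_zero order_trans)
    have xm: "m / 2 \<le> P z \<bullet> x" if "z \<in> unit_circle" for z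
    proof -
      have "b * dist x x0 \<le> b * r" using x mb by (intro mult_left_mono) auto
      also have "\<dots> = m / 2" using mb by (simp add: r_def)
      finally have "\<bar>P z \<bullet> (x - x0)\<bar> \<le> m / 2" using near[OF that] by simp
      moreover have "m \<le> P z \<bullet> x0" using mb that by blast
      ultimately show ?thesis unfolding inner_diff_right by linarith
    qed
    have xpos: "0 < P z \<bullet> x" if "z \<in> unit_circle" for z using xm[OF that] mb(1) by simp
    have xnz: "P z \<bullet> x \<noteq> 0" if "z \<in> unit_circle" for z using xpos[OF that] by simp
    have cf: "continuous_on unit_circle (\<lambda>z. (P z \<bullet> d) / (P z \<bullet> x0))"
      using pos_nz by (intro cont) auto
    have cg: "continuous_on unit_circle (\<lambda>z. (1 / (P z \<bullet> x)) *\<^sub>R P z)"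
      using xnz by (intro cont) auto
    have cg0: "continuous_on unit_circle (\<lambda>z. (1 / (P z \<bullet> x0)) *\<^sub>R P z)"
      using pos_nz by (intro cont) auto
    have "norm (secant x d) \<le> (2 * b / m) * hess_norm d"
      unfolding secant_def[of x] hess_norm_eq
    proof (rule circle_mean_norm_le_root[OF Psi Psi_mean cf cg])
      fix z :: complex assume z: "z \<in> unit_circle"
      have "norm ((1 / (P z \<bullet> x)) *\<^sub>R P z) = norm (P z) / (P z \<bullet> x)"
        using xpos[OF z] by simp
      also have "\<dots> \<le> b / (m / 2)" using xm[OF z] mb z by (intro frac_le) auto
      finally show "norm ((1 / (P z \<bullet> x)) *\<^sub>R P z) \<le> 2 * b / m" by (simp add: mult_ac)
    qed
    also have "\<dots> \<le> K * hess_norm d"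
      by (intro mult_right_mono hess_norm_nonneg) (simp add: K_def)
    finally have 1: "norm (secant x d) \<le> K * hess_norm d" .
    have "hess d = circle_mean (\<lambda>z. (\<Psi> z * ((P z \<bullet> d) / (P z \<bullet> x0))) *\<^sub>R ((1 / (P z \<bullet> x)) *\<^sub>R P z)
        + (\<Psi> z * ((P z \<bullet> d) / (P z \<bullet> x0))) *\<^sub>R ((1 / (P z \<bullet> x0)) *\<^sub>R P z - (1 / (P z \<bullet> x)) *\<^sub>R P z))"
      unfolding secant_def scaleR_add_right[symmetric] by (simp only: add_diff_eq add_diff_cancel_left')
    also have "\<dots> = secant x d + circle_mean (\<lambda>z. (\<Psi> z * ((P z \<bullet> d) / (P z \<bullet> x0))) *\<^sub>R
        ((1 / (P z \<bullet> x0)) *\<^sub>R P z - (1 / (P z \<bullet> x)) *\<^sub>R P z))"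
      unfolding secant_def by (rule circle_mean_add) (intro continuous_intros Psi_cont cf cg cg0)+
    finally have "norm (hess d - secant x d) = norm (circle_mean (\<lambda>z. (\<Psi> z * ((P z \<bullet> d) / (P z \<bullet> x0))) *\<^sub>R
        ((1 / (P z \<bullet> x0)) *\<^sub>R P z - (1 / (P z \<bullet> x)) *\<^sub>R P z)))"
      by simp
    also have "\<dots> \<le> (2 * b\<^sup>2 / m\<^sup>2 * dist x x0) * hess_norm d"
      unfolding hess_norm_eq
    proof (rule circle_mean_norm_le_root[OF Psi Psi_mean cf])
      show "continuous_on unit_circle (\<lambda>z. (1 / (P z \<bullet> x0)) *\<^sub>R P z - (1 / (P z \<bullet> x)) *\<^sub>R P z)"
        by (intro continuous_intros cg cg0)
      fix z :: complex assume z: "z \<in> unit_circle"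
      have "1 / (P z \<bullet> x0) - 1 / (P z \<bullet> x) = (P z \<bullet> (x - x0)) / ((P z \<bullet> x0) * (P z \<bullet> x))"
        using pos[OF z] xpos[OF z] by (simp add: inner_diff_right field_simps)
      then have "norm ((1 / (P z \<bullet> x0)) *\<^sub>R P z - (1 / (P z \<bullet> x)) *\<^sub>R P z)
          = \<bar>P z \<bullet> (x - x0)\<bar> * norm (P z) / ((P z \<bullet> x0) * (P z \<bullet> x))"
        using pos[OF z] xpos[OF z] by (simp add: abs_mult flip: scaleR_diff_left)
      also have "\<dots> \<le> (b * dist x x0) * b / (m * (m / 2))"
        using near[OF z] xm[OF z] mb z pos[OF z]
        by (intro frac_le mult_mono) (auto intro: less_imp_le)
      finally show "norm ((1 / (P z \<bullet> x0)) *\<^sub>R P z - (1 / (P z \<bullet> x)) *\<^sub>R P z) \<le> 2 * b\<^sup>2 / m\<^sup>2 * dist x x0"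
        by (simp add: power2_eq_square mult_ac)
    qed
    also have "\<dots> \<le> K * dist x x0 * hess_norm d"
      by (intro mult_right_mono hess_norm_nonneg) (simp_all add: K_def)
    finally show ?thesis using xpos 1 by blast
  qed
  then show thesis using r K that by blast
qed

text \<open>The bound \<open>\<bar>C (P z) \<bullet> u\<bar> \<le> t (P z \<bullet> x0)\<close> is inherited by \<open>hess (C u)\<close>: the numbers
  \<open>C (P z) \<bullet> P w\<close> are nonnegative, and their mean over \<open>w\<close> with weight \<open>\<Psi> w / (P w \<bullet> x0)\<close> is
  \<open>C (P z) \<bullet> e = P z \<bullet> x0\<close>.  This is
  the Perron--Frobenius bound for a positive operator with a positive fixed vector.\<close>

lemma powers_bounded:
  assumes C: "linear C" "\<And>u v. C u \<bullet> v = u \<bullet> C v" and Ce: "C e = x0"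
    and C_pos: "\<And>z w. 0 \<le> C (P z) \<bullet> P w"
  shows "\<exists>b. \<forall>k. norm (((hess \<circ> C) ^^ k) u) \<le> b"
proof -
  have contCP: "continuous_on unit_circle (\<lambda>z. C (P z))"
    using linear_continuous_on[of C UNIV] C(1) P
    by (auto simp: linear_conv_bounded_linear intro: continuous_on_compose2)
  have ne: "unit_circle \<noteq> {}" "compact unit_circle" by auto
  have "continuous_on unit_circle (\<lambda>z. \<bar>C (P z) \<bullet> u\<bar> / (P z \<bullet> x0))"
    using pos_nz by (intro cont contCP) auto
  then obtain y where y: "\<forall>z\<in>unit_circle. \<bar>C (P z) \<bullet> u\<bar> / (P z \<bullet> x0) \<le> \<bar>C (P y) \<bullet> u\<bar> / (P y \<bullet> x0)"
    using continuous_attains_sup[OF ne(2,1)] by blast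
  define t where "t = max 0 (\<bar>C (P y) \<bullet> u\<bar> / (P y \<bullet> x0))"
  have t: "t \<ge> 0" by (simp add: t_def)
  have start: "\<forall>z\<in>unit_circle. \<bar>C (P z) \<bullet> u\<bar> \<le> t * (P z \<bullet> x0)"
  proof
    fix z :: complex assume z: "z \<in> unit_circle"
    have "\<bar>C (P z) \<bullet> u\<bar> / (P z \<bullet> x0) \<le> t" using y z by (fastforce simp: t_def)
    then show "\<bar>C (P z) \<bullet> u\<bar> \<le> t * (P z \<bullet> x0)" using pos[OF z] by (simp add: field_simps)
  qed
  have ratio: "\<bar>\<Psi> w * ((P w \<bullet> C v) / (P w \<bullet> x0)) * (1 / (P w \<bullet> x0))\<bar> \<le> t * (\<Psi> w / (P w \<bullet> x0))"
    if v: "\<forall>z\<in>unit_circle. \<bar>C (P z) \<bullet> v\<bar> \<le> t * (P z \<bullet> x0)" and w: "w \<in> unit_circle" for v w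
  proof -
    have "\<bar>P w \<bullet> C v\<bar> \<le> t * (P w \<bullet> x0)" using v w C(2) by metis
    then have "\<bar>P w \<bullet> C v\<bar> / (P w \<bullet> x0) \<le> t" using pos[OF w] by (simp add: field_simps)
    then have "\<Psi> w / (P w \<bullet> x0) * (\<bar>P w \<bullet> C v\<bar> / (P w \<bullet> x0)) \<le> \<Psi> w / (P w \<bullet> x0) * t"
      using pos[OF w] Psi_pos[OF w] by (intro mult_left_mono) auto
    then show ?thesis using pos[OF w] Psi_pos[OF w] by (simp add: abs_mult mult_ac)
  qed
  have c1: "continuous_on unit_circle (\<lambda>w. (\<Psi> w / (P w \<bullet> x0)) *\<^sub>R P w)"
    using pos_nz by (intro cont) auto
  have c2: "continuous_on unit_circle (\<lambda>w. \<Psi> w * ((P w \<bullet> C v) / (P w \<bullet> x0)) * (1 / (P w \<bullet> x0)))" for v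
    using pos_nz by (intro cont) auto
  have step: "\<forall>z\<in>unit_circle. \<bar>C (P z) \<bullet> hess (C v)\<bar> \<le> t * (P z \<bullet> x0)"
    if v: "\<forall>z\<in>unit_circle. \<bar>C (P z) \<bullet> v\<bar> \<le> t * (P z \<bullet> x0)" for v
  proof
    fix z :: complex assume z: "z \<in> unit_circle"
    have lin: "linear (\<lambda>y. C (P z) \<bullet> y)" by (intro bounded_linear.linear bounded_linear_inner_right)
    have "C (P z) \<bullet> hess (C v) = circle_mean (\<lambda>w.
        (\<Psi> w * ((P w \<bullet> C v) / (P w \<bullet> x0)) * (1 / (P w \<bullet> x0))) * (C (P z) \<bullet> P w))"
      using circle_mean_linear[OF cont_secant_integrand[OF pos] lin, of "C v"]
      by (simp add: secant_def)
    then have "\<bar>C (P z) \<bullet> hess (C v)\<bar> = norm (circle_mean (\<lambda>w.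
        (\<Psi> w * ((P w \<bullet> C v) / (P w \<bullet> x0)) * (1 / (P w \<bullet> x0))) * (C (P z) \<bullet> P w)))"
      by simp
    also have "\<dots> \<le> circle_mean (\<lambda>w. t * (C (P z) \<bullet> ((\<Psi> w / (P w \<bullet> x0)) *\<^sub>R P w)))"
    proof (rule circle_mean_norm_le)
      fix w :: complex assume w: "w \<in> unit_circle"
      show "norm ((\<Psi> w * ((P w \<bullet> C v) / (P w \<bullet> x0)) * (1 / (P w \<bullet> x0))) * (C (P z) \<bullet> P w))
          \<le> t * (C (P z) \<bullet> ((\<Psi> w / (P w \<bullet> x0)) *\<^sub>R P w))"
        using mult_right_mono[OF ratio[OF v w] C_pos[of z w]] C_pos[of z w]
        unfolding real_norm_def abs_mult[of _ "C (P z) \<bullet> P w"] by simp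
    qed (intro continuous_intros c1 c2 P)+
    also have "\<dots> = t * (C (P z) \<bullet> e)"
      unfolding circle_mean_mult_left circle_mean_linear[OF c1 lin, symmetric] balanced by (rule refl)
    also have "C (P z) \<bullet> e = P z \<bullet> x0" using C(2) Ce by metis
    finally show "\<bar>C (P z) \<bullet> hess (C v)\<bar> \<le> t * (P z \<bullet> x0)" .
  qed
  have inv: "\<forall>z\<in>unit_circle. \<bar>C (P z) \<bullet> ((hess \<circ> C) ^^ k) u\<bar> \<le> t * (P z \<bullet> x0)" for k
  proof (induction k)
    case (Suc k)
    show ?case using step[OF Suc] by simp
  qed (use start in simp)
  define b where "b = circle_mean (\<lambda>w. t * (\<Psi> w / (P w \<bullet> x0)) * norm (P w))"
  have "norm (((hess \<circ> C) ^^ k) u) \<le> max (norm u) b" for k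
  proof (cases k)
    case (Suc j)
    let ?v = "((hess \<circ> C) ^^ j) u"
    have "norm (hess (C ?v)) \<le> b"
      unfolding b_def secant_def[of x0 "C ?v"]
    proof (rule circle_mean_norm_le)
      fix w :: complex assume w: "w \<in> unit_circle"
      show "norm ((\<Psi> w * ((P w \<bullet> C ?v) / (P w \<bullet> x0))) *\<^sub>R ((1 / (P w \<bullet> x0)) *\<^sub>R P w))
          \<le> t * (\<Psi> w / (P w \<bullet> x0)) * norm (P w)"
        using mult_right_mono[OF ratio[OF inv w, of j] norm_ge_zero[of "P w"]]
        by (simp only: scaleR_scaleR norm_scaleR)
    next
      show "continuous_on unit_circle (\<lambda>w. t * (\<Psi> w / (P w \<bullet> x0)) * norm (P w))"
        using pos_nz by (intro cont) auto
    qed (rule cont_secant_integrand[OF pos])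
    then show ?thesis using Suc by simp
  qed simp
  then show ?thesis by blast
qed

text \<open>With \<open>d = x - x0\<close> the step is \<open>F x - x0 = (d - C x0 (hess d)) + err\<close>.  The linear part
  contracts \<open>hess_norm\<close>, and the error is at most a multiple of \<open>dist x x0 * hess_norm d\<close>, hence
  absorbed for \<open>x\<close> near \<open>x0\<close>.\<close>

lemma converges_to_balanced:
  fixes C :: "'a \<Rightarrow> 'a \<Rightarrow> 'a" and E :: "'a \<Rightarrow> 'a"
  assumes U: "closed U" "x0 \<in> U" and r0: "0 < r0"
    and F: "\<And>x. x \<in> U \<Longrightarrow> dist x x0 \<le> r0 \<Longrightarrow> (\<forall>z\<in>unit_circle. 0 < P z \<bullet> x) \<Longrightarrow> F x = C x (moment x)"
    and FU: "\<And>x. x \<in> U \<Longrightarrow> dist x x0 \<le> r0 \<Longrightarrow> (\<forall>z\<in>unit_circle. 0 < P z \<bullet> x) \<Longrightarrow> F x \<in> U"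
    and C: "\<And>x. linear (C x)" "\<And>x. x \<in> U \<Longrightarrow> dist x x0 \<le> r0 \<Longrightarrow> C x e = x"
    and C_cont: "\<And>x y. x \<in> U \<Longrightarrow> dist x x0 \<le> r0 \<Longrightarrow> norm (C x0 y - C x y) \<le> \<kappa> * dist x x0 * norm y"
    and E: "linear E" "inj E" "\<And>u v. C x0 u \<bullet> v = E u \<bullet> E v"
    and C_pos: "\<And>z w. 0 \<le> C x0 (P z) \<bullet> P w"
  obtains \<delta> where "0 < \<delta>" "\<delta> \<le> r0"
    "\<forall>y. y 0 \<in> U \<longrightarrow> dist (y 0) x0 < \<delta> \<longrightarrow> (\<forall>k. y (Suc k) = F (y k)) \<longrightarrow>
       (\<exists>l\<in>U. dist l x0 \<le> r0 \<and> (\<forall>z\<in>unit_circle. 0 < P z \<bullet> l) \<and> moment l = e \<and> y \<longlonglongrightarrow> l)"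
proof -
  have C0e: "C x0 e = x0" using C(2)[OF U(2)] r0 by simp
  have C_sym: "C x0 u \<bullet> v = u \<bullet> C x0 v" for u v
    by (metis E(3) inner_commute)
  obtain \<rho> where \<rho>: "0 \<le> \<rho>" "\<rho> < 1"
    "\<forall>d. hess (d - C x0 (hess d)) \<bullet> (d - C x0 (hess d)) \<le> \<rho> * (hess d \<bullet> d)"
    by (rule preconditioned_step_contracts[OF linear_hess hess_sym hess_nonneg C(1)[of x0] E(3,1,2)
        powers_bounded[OF C(1) C_sym C0e C_pos]])
  obtain r1 K where r1: "0 < r1" and K: "0 < K" and
    sec: "\<forall>x d. dist x x0 \<le> r1 \<longrightarrow> (\<forall>z\<in>unit_circle. 0 < P z \<bullet> x) \<and> norm (secant x d) \<le> K * hess_norm d \<and>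
       norm (hess d - secant x d) \<le> K * dist x x0 * hess_norm d"
    by (rule secant_bounds)
  obtain c where c: "c > 0" "\<forall>d. hess_norm d \<le> c * norm d" by (rule hess_norm_le_norm)
  obtain c0 where c0: "c0 > 0" "\<And>y. norm (C x0 y) \<le> norm y * c0"
    using bounded_linear.pos_bounded C(1)[of x0] by (metis linear_conv_bounded_linear)
  define \<kappa>' where "\<kappa>' = max \<kappa> 0"
  have C_cont': "norm (C x0 y - C x y) \<le> \<kappa>' * dist x x0 * norm y" if "x \<in> U" "dist x x0 \<le> r0" for x y
  proof -
    have "\<kappa> * dist x x0 * norm y \<le> \<kappa>' * dist x x0 * norm y"
      by (intro mult_right_mono) (auto simp: \<kappa>'_def)
    then show ?thesis using C_cont[OF that, of y] by simp
  qed
  define Q where "Q = c0 * K + \<kappa>' * K"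
  have Q: "Q > 0" using c0 K by (auto simp: Q_def \<kappa>'_def intro!: add_pos_nonneg)
  \<comment> \<open>This \<open>\<epsilon>\<close> gives \<open>(1 + \<epsilon>) \<rho> \<le> 1 - \<epsilon>\<close>, and \<open>r\<close> is so small that the squared error uses up at
    most half of the remaining margin \<open>\<epsilon>\<close>.\<close>
  define \<epsilon> where "\<epsilon> = (1 - \<rho>) / 2"
  have \<epsilon>: "\<epsilon> > 0" using \<rho> by (simp add: \<epsilon>_def)
  define \<eta> where "\<eta> = (1 + 1 / \<epsilon>) * (c * Q)\<^sup>2"
  have \<eta>: "\<eta> > 0" using \<epsilon> c Q by (simp add: \<eta>_def add_pos_pos)
  define r where "r = min (min r0 r1) (min 1 (\<epsilon> / (2 * \<eta>)))"
  have r: "0 < r" "r \<le> r0" "r \<le> r1" "r \<le> 1" "\<eta> * r \<le> \<epsilon> / 2"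
  proof -
    have "r \<le> \<epsilon> / (2 * \<eta>)" by (simp add: r_def)
    then show "\<eta> * r \<le> \<epsilon> / 2" using \<eta> by (simp add: field_simps)
  qed (use r0 r1 \<epsilon> \<eta> in \<open>auto simp: r_def\<close>)
  define \<sigma> where "\<sigma> = sqrt (1 - \<epsilon> / 2)"
  have \<epsilon>1: "\<epsilon> \<le> 1 / 2" using \<rho> by (simp add: \<epsilon>_def)
  have \<sigma>: "0 \<le> \<sigma>" "\<sigma> < 1" using \<epsilon> \<epsilon>1 by (auto simp: \<sigma>_def)
  have Fx: "F x = x - C x (secant x (x - x0))" if x: "x \<in> U" "dist x x0 \<le> r" for x
  proof -
    have p: "\<forall>z\<in>unit_circle. 0 < P z \<bullet> x" and x': "dist x x0 \<le> r0" using sec x r by auto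
    show ?thesis
      using F[OF x(1) x' p] moment_eq[of x] p C(2)[OF x(1) x'] by (simp add: linear_diff[OF C(1)])
  qed
  have N_step: "hess_norm (F x - x0) \<le> \<sigma> * hess_norm (x - x0)" if x: "x \<in> U" "dist x x0 \<le> r" for x
  proof -
    let ?d = "x - x0" and ?\<delta> = "dist x x0"
    define a where "a = ?d - C x0 (hess ?d)"
    define b where "b = C x0 (hess ?d - secant x ?d) + (C x0 (secant x ?d) - C x (secant x ?d))"
    have "F x - x0 = a + b"
      by (simp add: Fx[OF x] a_def b_def linear_diff[OF C(1)])
    have x1: "dist x x0 \<le> r1" and x0': "dist x x0 \<le> r0" using x r by auto
    have "norm b \<le> norm (hess ?d - secant x ?d) * c0 + \<kappa>' * ?\<delta> * norm (secant x ?d)"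
      unfolding b_def by (rule norm_triangle_le) (intro add_mono c0 C_cont' x x0')
    also have "\<dots> \<le> (K * ?\<delta> * hess_norm ?d) * c0 + \<kappa>' * ?\<delta> * (K * hess_norm ?d)"
      using sec x1 c0 by (intro add_mono mult_left_mono mult_right_mono) (auto simp: \<kappa>'_def)
    also have "\<dots> = Q * ?\<delta> * hess_norm ?d" by (simp add: Q_def algebra_simps)
    finally have b: "norm b \<le> Q * ?\<delta> * hess_norm ?d" .
    have "hess_norm b \<le> c * norm b" using c by blast
    also have "\<dots> \<le> c * (Q * ?\<delta> * hess_norm ?d)" using b c by (intro mult_left_mono) auto
    finally have gb: "(hess_norm b)\<^sup>2 \<le> (c * (Q * ?\<delta> * hess_norm ?d))\<^sup>2"
      by (rule power_mono) (rule hess_norm_nonneg)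
    have "(hess_norm (F x - x0))\<^sup>2 \<le> (1 + \<epsilon>) * (hess_norm a)\<^sup>2 + (1 + 1 / \<epsilon>) * (hess_norm b)\<^sup>2"
      unfolding \<open>F x - x0 = a + b\<close> by (rule hess_norm_add_le[OF \<epsilon>])
    also have "\<dots> \<le> (1 + \<epsilon>) * (\<rho> * (hess_norm ?d)\<^sup>2) + (1 + 1 / \<epsilon>) * (c * (Q * ?\<delta> * hess_norm ?d))\<^sup>2"
      using \<rho>(3) \<epsilon> gb unfolding hess_norm_square a_def by (intro add_mono mult_left_mono) auto
    also have "\<dots> = ((1 + \<epsilon>) * \<rho> + \<eta> * ?\<delta>\<^sup>2) * (hess_norm ?d)\<^sup>2"
      by (simp add: \<eta>_def power_mult_distrib algebra_simps)
    also have "\<dots> \<le> (1 - \<epsilon> / 2) * (hess_norm ?d)\<^sup>2"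
    proof (rule mult_right_mono)
      have "?\<delta>\<^sup>2 \<le> 1 * r"
        unfolding power2_eq_square using x r by (intro mult_mono) auto
      then have "\<eta> * ?\<delta>\<^sup>2 \<le> \<eta> * r" using \<eta> by (intro mult_left_mono) auto
      then have "\<eta> * ?\<delta>\<^sup>2 \<le> \<epsilon> / 2" using r(5) by linarith
      moreover have "\<epsilon> * \<rho> \<le> \<epsilon> * 1" using \<epsilon> \<rho> by (intro mult_left_mono) auto
      moreover have "\<rho> = 1 - 2 * \<epsilon>" by (simp add: \<epsilon>_def field_simps)
      ultimately show "(1 + \<epsilon>) * \<rho> + \<eta> * ?\<delta>\<^sup>2 \<le> 1 - \<epsilon> / 2"
        by (simp add: distrib_right)
    qed simp
    also have "\<dots> = (\<sigma> * hess_norm ?d)\<^sup>2" using \<epsilon>1 by (simp add: \<sigma>_def power_mult_distrib)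
    finally show ?thesis
      by (rule power2_le_imp_le) (simp add: \<sigma> hess_norm_nonneg)
  qed
  have step: "dist (F x) x \<le> (c0 + \<kappa>') * K * hess_norm (x - x0)" if x: "x \<in> U" "dist x x0 \<le> r" for x
  proof -
    let ?s = "secant x (x - x0)"
    have x1: "dist x x0 \<le> r1" and x0': "dist x x0 \<le> r0" and x2: "dist x x0 \<le> 1" using x r by auto
    have "dist (F x) x = norm (C x0 ?s - (C x0 ?s - C x ?s))" by (simp add: Fx[OF x] dist_norm)
    also have "\<dots> \<le> norm ?s * c0 + \<kappa>' * dist x x0 * norm ?s"
      by (rule norm_triangle_le_diff) (intro add_mono c0 C_cont' x x0')
    also have "\<dots> \<le> norm ?s * c0 + \<kappa>' * 1 * norm ?s"
      using x2 by (intro add_mono mult_left_mono mult_right_mono) (auto simp: \<kappa>'_def)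
    also have "\<dots> = (c0 + \<kappa>') * norm ?s" by (simp add: algebra_simps)
    also have "\<dots> \<le> (c0 + \<kappa>') * (K * hess_norm (x - x0))"
      using sec x1 c0 by (intro mult_left_mono) (auto simp: \<kappa>'_def)
    finally show ?thesis by (simp add: mult_ac)
  qed
  obtain \<delta> where \<delta>: "0 < \<delta>" "\<delta> \<le> r" and
    conv: "\<forall>y. y 0 \<in> U \<longrightarrow> dist (y 0) x0 < \<delta> \<longrightarrow> (\<forall>k. y (Suc k) = F (y k)) \<longrightarrow>
       (\<exists>l\<in>U. dist l x0 \<le> r \<and> hess_norm (l - x0) = 0 \<and> y \<longlonglongrightarrow> l)"
  proof (rule gauge_contraction_converges[OF r(1) \<sigma> _ U(1) hess_norm_nonneg _ hess_norm_cont N_step step])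
    show "0 \<le> (c0 + \<kappa>') * K" using c0 K by (simp add: \<kappa>'_def)
    show "hess_norm (x - x0) \<le> c * dist x x0" for x using c by (simp add: dist_norm)
    show "F x \<in> U" if "x \<in> U" "dist x x0 \<le> r" for x
      using FU that r sec by (meson order_trans)
  qed
  have "\<exists>l\<in>U. dist l x0 \<le> r0 \<and> (\<forall>z\<in>unit_circle. 0 < P z \<bullet> l) \<and> moment l = e \<and> y \<longlonglongrightarrow> l"
    if y: "y 0 \<in> U" "dist (y 0) x0 < \<delta>" "\<forall>k. y (Suc k) = F (y k)" for y
  proof -
    obtain l where l: "l \<in> U" "dist l x0 \<le> r" "hess_norm (l - x0) = 0" "y \<longlonglongrightarrow> l"
      using conv y by blast
    have l1: "\<forall>z\<in>unit_circle. 0 < P z \<bullet> l" "norm (secant l (l - x0)) \<le> K * hess_norm (l - x0)"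
      using sec l(2) r(3) by (meson order_trans)+
    then have "moment l = e" using moment_eq[of l] l(3) by simp
    moreover have "dist l x0 \<le> r0" using l(2) r(2) by simp
    ultimately show ?thesis using l(1,4) l1(1) by blast
  qed
  then show thesis
    using \<delta> r(2) by (intro that[of \<delta>]) auto
qed

end

section \<open>The transfer function on the circle\<close>

lemma continuous_on_det:
  fixes M :: "complex \<Rightarrow> complex^'n^'n"
  assumes "\<And>i j. continuous_on S (\<lambda>z. M z $ i $ j)"
  shows "continuous_on S (\<lambda>z. det (M z))"
  unfolding det_def by (intro continuous_intros assms)

text \<open>The spectrum avoids the circle, so that Cramer's rule gives the entries as quotients of
  polynomials without poles there.\<close>

lemma continuous_on_transfer:
  fixes A :: "complex^'n^'n"
  assumes "\<And>c. is_eigenvalue A c \<Longrightarrow> norm c < 1"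
  shows "continuous_on unit_circle (transfer A B)"
proof -
  have det: "det (mat z - A) \<noteq> 0" if "z \<in> unit_circle" for z
  proof
    assume "det (mat z - A) = 0"
    then obtain v where v: "v \<noteq> 0" "(mat z - A) *v v = 0"
      using invertible_det_nz[of "mat z - A"] matrix_left_invertible_ker[of "mat z - A"]
      by (auto simp: invertible_left_inverse)
    have "mat z *v v = z *s v"
      by (simp add: matrix_vector_mult_def mat_def vec_eq_iff if_distrib[of "\<lambda>x. x * _"] cong: if_cong)
    then have "A *v v = z *s v"
      using v(2) by (simp add: matrix_vector_mult_diff_rdistrib)
    then have "norm z < 1" using assms v(1) by (auto simp: is_eigenvalue_def)
    then show False using that by simp
  qed
  have entry: "continuous_on unit_circle (\<lambda>z. (mat z - A) $ i $ j)" for i j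
    by (cases "i = j") (auto simp: mat_def intro!: continuous_intros)
  let ?cr = "\<lambda>z k. det (\<chi> i j. if j = k then B $ i else (mat z - A) $ i $ j) / det (mat z - A)"
  have "transfer A B z = (\<chi> k. ?cr z k)" if "z \<in> unit_circle" for z
  proof -
    have "invertible (mat z - A)" using det[OF that] by (simp add: invertible_det_nz)
    then have "(mat z - A) *v transfer A B z = B"
      using someI_ex[of "\<lambda>M. (mat z - A) ** M = mat 1 \<and> M ** (mat z - A) = mat 1"]
      by (simp add: transfer_def matrix_vector_mul_assoc matrix_inv_def invertible_def)
    then show ?thesis using cramer[OF det[OF that]] by blast
  qed
  moreover have "continuous_on unit_circle (\<lambda>z. \<chi> k. ?cr z k)"
  proof (intro continuous_on_vec_lambda continuous_on_divide continuous_on_det)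
    show "continuous_on unit_circle (\<lambda>z. (\<chi> i j. if j = k then B $ i else (mat z - A) $ i $ j) $ i $ j)"
      for i j k
      using entry[of i j] by (cases "j = k") (auto intro!: continuous_intros)
  qed (use entry det in auto)
  ultimately show ?thesis
    by (subst continuous_on_cong[OF refl])
qed

section \<open>Local asymptotic stability\<close>

definition sandwich :: "complex^'n^'n \<Rightarrow> complex^'n^'n \<Rightarrow> complex^'n^'n" where
  "sandwich L Y = msqrt L ** Y ** msqrt L"

lemma linear_sandwich: "linear (sandwich L)"
proof -
  interpret bounded_bilinear "(**) :: complex^'n^'n \<Rightarrow> complex^'n^'n \<Rightarrow> complex^'n^'n"
    by (rule bounded_bilinear_matrix_mult)
  show ?thesis
    by (rule linearI) (simp_all add: sandwich_def add_left add_right scaleR_left scaleR_right)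
qed

lemma sandwich_mat_1: "posdef L \<Longrightarrow> sandwich L (mat 1) = L"
  by (simp add: sandwich_def msqrt_square)

lemma sandwich_lipschitz_at:
  fixes L :: "complex^'n^'n"
  assumes "posdef L"
  obtains \<kappa> where
    "\<forall>L' Y. posdef L' \<longrightarrow> dist L' L \<le> 1 \<longrightarrow> norm (sandwich L Y - sandwich L' Y) \<le> \<kappa> * dist L' L * norm Y"
proof -
  interpret bounded_bilinear "(**) :: complex^'n^'n \<Rightarrow> complex^'n^'n \<Rightarrow> complex^'n^'n"
    by (rule bounded_bilinear_matrix_mult)
  obtain k where k: "k > 0" "\<forall>M N. norm ((M :: complex^'n^'n) ** (N :: complex^'n^'n)) \<le> norm M * norm N * k"
    using pos_bounded by blast
  obtain c where c: "c > 0" "\<And>L'. posdef L' \<Longrightarrow> norm (msqrt L' - msqrt L) \<le> c * norm (L' - L)"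
    using msqrt_lipschitz_at[OF assms] by metis
  define s where "s = norm (msqrt L)"
  define \<kappa> where "\<kappa> = (2 * s + c) * c * k\<^sup>2"
  have "norm (sandwich L Y - sandwich L' Y) \<le> \<kappa> * dist L' L * norm Y"
    if L': "posdef L'" "dist L' L \<le> 1" for L' Y
  proof -
    let ?S = "msqrt L" and ?T = "msqrt L'" and ?\<delta> = "dist L' L"
    have ST: "norm (?S - ?T) \<le> c * ?\<delta>"
      using c(2)[OF L'(1)] by (simp add: norm_minus_commute dist_norm)
    have T: "norm ?T \<le> s + c"
    proof -
      have "norm ?T \<le> norm ?S + norm (?S - ?T)" by (metis norm_minus_commute norm_triangle_sub)
      also have "norm (?S - ?T) \<le> c * 1" using ST c(1) L'(2) by (meson mult_left_mono less_imp_le order_trans)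
      finally show ?thesis by (simp add: s_def)
    qed
    have trip: "norm (M ** Y ** N) \<le> norm M * norm N * norm Y * k\<^sup>2" for M N :: "complex^'n^'n"
    proof -
      have "norm (M ** Y ** N) \<le> norm (M ** Y) * norm N * k" using k by blast
      also have "\<dots> \<le> (norm M * norm Y * k) * norm N * k"
        using k by (intro mult_right_mono) auto
      finally show ?thesis by (simp add: power2_eq_square mult_ac)
    qed
    have "sandwich L Y - sandwich L' Y = (?S - ?T) ** Y ** ?S + ?T ** Y ** (?S - ?T)"
      by (simp add: sandwich_def diff_left diff_right)
    also have "norm \<dots> \<le> norm (?S - ?T) * s * norm Y * k\<^sup>2 + norm ?T * norm (?S - ?T) * norm Y * k\<^sup>2"
      unfolding s_def by (rule norm_triangle_le) (intro add_mono trip)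
    also have "\<dots> \<le> (c * ?\<delta>) * s * norm Y * k\<^sup>2 + (s + c) * (c * ?\<delta>) * norm Y * k\<^sup>2"
      using ST T c(1) by (intro add_mono mult_mono) (auto simp: s_def)
    also have "\<dots> = \<kappa> * ?\<delta> * norm Y" by (simp add: \<kappa>_def algebra_simps)
    finally show ?thesis .
  qed
  then show thesis using that by blast
qed

text \<open>Two square roots are taken: with \<open>R = L\<^sup>1\<^sup>/\<^sup>4\<close> the sandwich form is the Frobenius form pulled
  back along \<open>Y \<mapsto> R Y R\<close>.\<close>

lemma sandwich_form:
  fixes L :: "complex^'n^'n"
  assumes "posdef L"
  obtains E :: "complex^'n^'n \<Rightarrow> complex^'n^'n" where "linear E" "inj E"
    "\<forall>u v. sandwich L u \<bullet> v = E u \<bullet> E v"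
proof -
  define S where "S = msqrt L"
  define R where "R = msqrt S"
  have S: "posdef S" using assms by (simp add: S_def posdef_msqrt)
  have R: "posdef R" "R ** R = S" using S by (simp_all add: R_def posdef_msqrt msqrt_square)
  have Rh: "ctranspose R = R" using R by (simp add: posdef_def hermitian_def)
  interpret bounded_bilinear "(**) :: complex^'n^'n \<Rightarrow> complex^'n^'n \<Rightarrow> complex^'n^'n"
    by (rule bounded_bilinear_matrix_mult)
  define E where "E = sandwich S"
  have E_def': "E u = R ** u ** R" for u by (simp add: E_def sandwich_def R_def)
  have lin: "linear E" by (simp add: E_def linear_sandwich)
  have form: "sandwich L u \<bullet> v = E u \<bullet> E v" for u v
  proof -
    have "sandwich L u \<bullet> v = (R ** (R ** u ** R ** R)) \<bullet> v"
      by (simp add: sandwich_def matrix_mul_assoc R(2)[symmetric] flip: S_def)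
    also have "\<dots> = (R ** u ** R ** R) \<bullet> (R ** v)"
      by (simp add: inner_matrix_mult_left Rh)
    also have "\<dots> = E u \<bullet> E v"
      unfolding E_def' by (simp add: inner_matrix_mult_right[of _ R] Rh)
    finally show ?thesis .
  qed
  have "inj R'" if "R' = (\<lambda>u. R ** u)" for R' :: "complex^'n^'n \<Rightarrow> complex^'n^'n"
    unfolding that
  proof (rule injI)
    fix u v :: "complex^'n^'n" assume "R ** u = R ** v"
    then have "R ** (u - v) = 0" by (simp add: diff_right)
    moreover obtain q where "q > 0" "\<forall>x. q * (x \<bullet> x) \<le> x \<bullet> (R *v x)"
      using posdef_coercive[OF R(1)] by blast
    ultimately have "q * ((u - v) \<bullet> (u - v)) \<le> 0"
      using inner_posdef_mult_ge[of q R "u - v"] by simp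
    then show "u = v" using \<open>q > 0\<close> by (simp add: mult_le_0_iff not_less flip: power2_norm_eq_inner)
  qed
  then have inj_left: "R ** u = R ** v \<Longrightarrow> u = v" for u v :: "complex^'n^'n"
    by (auto dest: injD)
  have "inj E"
  proof (rule injI)
    fix u v assume "E u = E v"
    then have "u ** R = v ** R" unfolding E_def' matrix_mul_assoc[symmetric] by (rule inj_left)
    then have "ctranspose (u ** R) = ctranspose (v ** R)" by simp
    then have "ctranspose u = ctranspose v" 
      using inj_left[of "ctranspose u" "ctranspose v"] by (simp add: ctranspose_mult Rh)
    from arg_cong[OF this, of ctranspose] show "u = v" by simp
  qed
  then show thesis using lin form by (intro that[of E]) auto
qed

theorem mainTheorem1:
  fixes A :: "complex^'n^'n" and B :: "complex^'n" and \<Psi> :: "complex \<Rightarrow> real"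
  assumes spectrum_in_disc: "\<And>c. is_eigenvalue A c \<Longrightarrow> norm c < 1"
    and zero_eigenvalue: "is_eigenvalue A 0"
    and reach: "reachable A B"
    and Psi: "\<Psi> \<in> Cplus"
    and Psi_mean: "circle_mean \<Psi> = 1"
    and feasible: "\<exists>\<Phi>\<in>Cplus. circle_mean (\<lambda>z. \<Phi> z *\<^sub>R outer (transfer A B z)) = mat 1"
    and normalized: "\<And>\<Phi>. \<Phi> \<in> Cplus \<Longrightarrow>
        circle_mean (\<lambda>z. \<Phi> z *\<^sub>R outer (transfer A B z)) = mat 1 \<Longrightarrow> circle_mean \<Phi> = 1"
  shows "\<forall>L0 \<in> L_circ_plus A B \<Psi>.
    \<exists>N. openin (top_of_set {M. hermitian M}) N \<and> L0 \<in> N \<and> N \<subseteq> {M. posdef M} \<and>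
      (\<forall>L :: nat \<Rightarrow> complex^'n^'n.
         L 0 \<in> N \<and> (\<forall>k. L (Suc k) = Theta A B \<Psi> (L k)) \<longrightarrow>
         (\<lambda>k. infdist (L k) (L_circ_plus A B \<Psi>)) \<longlonglongrightarrow> 0)"
proof
  fix L0 assume "L0 \<in> L_circ_plus A B \<Psi>"
  then have L0: "posdef L0" "\<And>z. z \<in> unit_circle \<Longrightarrow> 0 < Re (cform L0 (transfer A B z))"
    and L0_bal: "circle_mean (\<lambda>z. (\<Psi> z / Re (cform L0 (transfer A B z))) *\<^sub>R outer (transfer A B z)) = mat 1"
    by (auto simp: L_circ_plus_def L_circ_def)
  define P where "P z = outer (transfer A B z)" for z
  have form: "Re (cform L (transfer A B z)) = P z \<bullet> L" for L z
    by (simp add: P_def Re_cform inner_outer)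
  have P_cont: "continuous_on unit_circle P"
    unfolding P_def by (intro continuous_on_outer continuous_on_transfer spectrum_in_disc)
  interpret circle_iteration \<Psi> P L0 "mat 1"
    by unfold_locales
      (use Psi Psi_mean P_cont L0 L0_bal in \<open>auto simp: form simp flip: P_def\<close>)
  have L0h: "hermitian L0" using L0 by (simp add: posdef_def)
  obtain r1 where r1: "r1 > 0" "ball L0 r1 \<inter> {M. hermitian M} \<subseteq> {M. posdef M}"
    using openin_posdef L0(1) unfolding openin_contains_ball by blast
  define r0 where "r0 = min 1 (r1 / 2)"
  have r0: "0 < r0" "r0 \<le> 1" "r0 < r1" using r1(1) by (auto simp: r0_def)
  have near: "posdef L" if "L \<in> {M. hermitian M}" "dist L L0 \<le> r0" for L
  proof -
    have "L \<in> ball L0 r1" using that(2) r0(3) by (simp add: dist_commute)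
    then show ?thesis using that(1) r1(2) by blast
  qed
  have cont_moment: "continuous_on unit_circle (\<lambda>z. (\<Psi> z / (P z \<bullet> L)) *\<^sub>R P z)"
    if "\<forall>z\<in>unit_circle. 0 < P z \<bullet> L" for L
    using that by (intro cont) (auto simp: less_le)
  have Theta: "Theta A B \<Psi> L = sandwich L (moment L)" if "\<forall>z\<in>unit_circle. 0 < P z \<bullet> L" for L
    unfolding moment_def circle_mean_linear[OF cont_moment[OF that] linear_sandwich]
    by (simp add: Theta_def sandwich_def form flip: P_def)
  have moment_h: "hermitian (moment L)" if "\<forall>z\<in>unit_circle. 0 < P z \<bullet> L" for L
  proof -
    have "ctranspose (P z) = P z" for z using hermitian_outer by (simp add: P_def hermitian_def)
    then show ?thesis
      unfolding hermitian_def moment_def circle_mean_linear[OF cont_moment[OF that] linear_ctranspose]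
      by (simp add: linear_cmul[OF linear_ctranspose])
  qed
  obtain E :: "complex^'n^'n \<Rightarrow> complex^'n^'n" where E: "linear E" "inj E" "\<forall>u v. sandwich L0 u \<bullet> v = E u \<bullet> E v"
    by (rule sandwich_form[OF L0(1)])
  obtain \<kappa> where \<kappa>: "\<forall>L' Y. posdef L' \<longrightarrow> dist L' L0 \<le> 1 \<longrightarrow>
      norm (sandwich L0 Y - sandwich L' Y) \<le> \<kappa> * dist L' L0 * norm Y"
    by (rule sandwich_lipschitz_at[OF L0(1)])
  obtain \<delta> where \<delta>: "0 < \<delta>" "\<delta> \<le> r0" and conv:
    "\<forall>y. y 0 \<in> {M. hermitian M} \<longrightarrow> dist (y 0) L0 < \<delta> \<longrightarrow> (\<forall>k. y (Suc k) = Theta A B \<Psi> (y k)) \<longrightarrow>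
       (\<exists>l\<in>{M. hermitian M}. dist l L0 \<le> r0 \<and> (\<forall>z\<in>unit_circle. 0 < P z \<bullet> l) \<and> moment l = mat 1 \<and> y \<longlonglongrightarrow> l)"
  proof (rule converges_to_balanced[where C = sandwich and E = E and \<kappa> = \<kappa> and F = "Theta A B \<Psi>",
        OF closed_hermitian _ r0(1)])
    show "Theta A B \<Psi> L = sandwich L (moment L)" if "\<forall>z\<in>unit_circle. 0 < P z \<bullet> L" for L
      using Theta[OF that] .
    show "Theta A B \<Psi> L \<in> {M. hermitian M}"
      if "L \<in> {M. hermitian M}" "dist L L0 \<le> r0" "\<forall>z\<in>unit_circle. 0 < P z \<bullet> L" for L
    proof -
      have "hermitian (msqrt L)" using posdef_msqrt[OF near[OF that(1,2)]] by (simp add: posdef_def)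
      then show ?thesis
        using moment_h[OF that(3)] by (simp add: Theta[OF that(3)] sandwich_def hermitian_sandwich)
    qed
    show "sandwich L (mat 1) = L" if "L \<in> {M. hermitian M}" "dist L L0 \<le> r0" for L
      using near[OF that] by (rule sandwich_mat_1)
    show "norm (sandwich L0 Y - sandwich L Y) \<le> \<kappa> * dist L L0 * norm Y"
      if "L \<in> {M. hermitian M}" "dist L L0 \<le> r0" for L Y
    proof -
      have "dist L L0 \<le> 1" using that(2) r0(2) by simp
      then show ?thesis using \<kappa> near[OF that] by blast
    qed
    have "hermitian (msqrt L0)" using posdef_msqrt[OF L0(1)] by (simp add: posdef_def)
    then show "0 \<le> sandwich L0 (P z) \<bullet> P w" for z w
      by (simp add: sandwich_def P_def mult_outer_mult inner_outer_outer_nonneg)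
  qed (use L0h linear_sandwich E in auto)
  define N where "N = {M. hermitian M} \<inter> ball L0 \<delta>"
  have "(\<lambda>k. infdist (L k) (L_circ_plus A B \<Psi>)) \<longlonglongrightarrow> 0"
    if L: "L 0 \<in> N" "\<forall>k. L (Suc k) = Theta A B \<Psi> (L k)" for L
  proof -
    obtain l where l: "hermitian l" "dist l L0 \<le> r0" "\<forall>z\<in>unit_circle. 0 < P z \<bullet> l"
        "moment l = mat 1" "L \<longlonglongrightarrow> l"
      using conv L by (auto simp: N_def dist_commute)
    have "posdef l" using near l(1,2) by blast
    then have l_mem: "l \<in> L_circ_plus A B \<Psi>"
      using l unfolding L_circ_plus_def L_circ_def moment_def by (simp add: form flip: P_def)
    show ?thesis
    proof (rule tendsto_sandwich[OF _ _ tendsto_const])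
      show "(\<lambda>k. dist (L k) l) \<longlonglongrightarrow> 0" using l(5) by (rule tendsto_dist_iff[THEN iffD1])
      show "\<forall>\<^sub>F k in sequentially. infdist (L k) (L_circ_plus A B \<Psi>) \<le> dist (L k) l"
        by (intro always_eventually allI infdist_le l_mem)
    qed (simp add: infdist_nonneg)
  qed
  moreover have "openin (top_of_set {M. hermitian M}) N"
    unfolding N_def by (intro openin_open_Int open_ball)
  moreover have "L0 \<in> N" "N \<subseteq> {M. posdef M}"
    using L0h \<delta> near by (auto simp: N_def dist_commute)
  ultimately show "\<exists>N. openin (top_of_set {M. hermitian M}) N \<and> L0 \<in> N \<and> N \<subseteq> {M. posdef M} \<and>
      (\<forall>L :: nat \<Rightarrow> complex^'n^'n.
         L 0 \<in> N \<and> (\<forall>k. L (Suc k) = Theta A B \<Psi> (L k)) \<longrightarrow>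
         (\<lambda>k. infdist (L k) (L_circ_plus A B \<Psi>)) \<longlonglongrightarrow> 0)"
    by blast
qed

end
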